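(* Let $R$ be an infinite commutative ring with $1$. For each $\mathsf{C}\in\{\mathrm{VI}(R),\mathrm{VIC}(R),\mathrm{SI}(R)\}$, the category of $\mathsf{C}$-modules is not locally Noetherian.
   Context: All rings are commutative with $1$. $\mathrm{VI}(R)$: objects are finite-rank free $R$-modules; morphisms are $R$-linear injections having an $R$-linear left inverse. $\mathrm{VIC}(R)$: objects are finite-rank free $R$-modules; morphisms $V\to W$ are pairs $(f,C)$ with $f:V\to W$ an $R$-linear injection and $C\subset W$ a free $R$-submodule with $W=f(V)\oplus C$; composition is $(g,D)\circ(f,C)=(g\circ f,g(C)\oplus D)$. $\mathrm{SI}(R)$: objects are finite-rank free $R$-modules $V$ equipped with a symplectic form, i.e. an alternating bilinear form $V\times V\to R$ inducing an isomorphism $V\to\operatorname{Hom}_R(V,R)$; morphisms are $R$-linear maps preserving the forms. For a category $\mathsf{C}$ and a ring $\mathbf{k}$, a $\mathsf{C}$-module over $\mathbf{k}$ is a functor $M$ from $\mathsf{C}$ to $\mathbf{k}$-modules; submodules are defined pointwise. $M$ is finitely generated if there are finitely many objects $C_i$ and elements $x_i\in M_{C_i}$ such that the smallest submodule of $M$ containing all $x_i$ is $M$. The category of $\mathsf{C}$-modules over $\mathbf{k}$ is locally Noetherian if every submodule of a finitely generated $\mathsf{C}$-module over $\mathbf{k}$ is finitely generated. The category of $\mathsf{C}$-modules is locally Noetherian if this holds over every Noetherian ring $\mathbf{k}$. *)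

theory Defs
  imports "HOL-Algebra.Module" "HOL-Algebra.Ring_Divisibility"
begin

section \<open>Linear maps and free modules\<close>

definition linear_maps ::
    "'r ring \<Rightarrow> ('r, 'v) module \<Rightarrow> ('r, 'w) module \<Rightarrow> ('v \<Rightarrow> 'w) set" where
  "linear_maps R V W = {f \<in> carrier V \<rightarrow> carrier W.
     (\<forall>x\<in>carrier V. \<forall>y\<in>carrier V. f (x \<oplus>\<^bsub>V\<^esub> y) = f x \<oplus>\<^bsub>W\<^esub> f y) \<and>
     (\<forall>a\<in>carrier R. \<forall>x\<in>carrier V. f (a \<odot>\<^bsub>V\<^esub> x) = a \<odot>\<^bsub>W\<^esub> f x)}"

definition is_basis :: "'r ring \<Rightarrow> ('r, 'v) module \<Rightarrow> 'v set \<Rightarrow> bool" where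
  "is_basis R V B \<longleftrightarrow> B \<subseteq> carrier V \<and>
     (\<forall>v\<in>carrier V. \<exists>A c. finite A \<and> A \<subseteq> B \<and> c \<in> A \<rightarrow> carrier R \<and>
        v = (\<Oplus>\<^bsub>V\<^esub>b\<in>A. c b \<odot>\<^bsub>V\<^esub> b)) \<and>
     (\<forall>A c. finite A \<and> A \<subseteq> B \<and> c \<in> A \<rightarrow> carrier R \<and>
        (\<Oplus>\<^bsub>V\<^esub>b\<in>A. c b \<odot>\<^bsub>V\<^esub> b) = \<zero>\<^bsub>V\<^esub> \<longrightarrow> (\<forall>b\<in>A. c b = \<zero>\<^bsub>R\<^esub>))"

definition free_module :: "'r ring \<Rightarrow> ('r, 'v) module \<Rightarrow> bool" where
  "free_module R V \<longleftrightarrow> module R V \<and> (\<exists>B. is_basis R V B)"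

definition finite_rank_free :: "'r ring \<Rightarrow> ('r, 'v) module \<Rightarrow> bool" where
  "finite_rank_free R V \<longleftrightarrow> module R V \<and> (\<exists>B. finite B \<and> is_basis R V B)"


section \<open>Categories and their modules\<close>

record ('o, 'm) category =
  Obj :: "'o set"
  Mor :: "'o \<Rightarrow> 'o \<Rightarrow> 'm set"
  Ident :: "'o \<Rightarrow> 'm"
  Compos :: "'o \<Rightarrow> 'o \<Rightarrow> 'o \<Rightarrow> 'm \<Rightarrow> 'm \<Rightarrow> 'm"

text \<open>\<open>Compos C X Y Z g f\<close> is the composite of \<open>f : X \<rightarrow> Y\<close> followed by \<open>g : Y \<rightarrow> Z\<close>.\<close>

record ('o, 'm, 'k, 'e) cmod =
  at_obj :: "'o \<Rightarrow> ('k, 'e) module"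
  at_mor :: "'o \<Rightarrow> 'o \<Rightarrow> 'm \<Rightarrow> 'e \<Rightarrow> 'e"

definition is_cmodule ::
    "('o, 'm) category \<Rightarrow> 'k ring \<Rightarrow> ('o, 'm, 'k, 'e) cmod \<Rightarrow> bool" where
  "is_cmodule C k M \<longleftrightarrow>
     (\<forall>X\<in>Obj C. module k (at_obj M X)) \<and>
     (\<forall>X\<in>Obj C. \<forall>Y\<in>Obj C. \<forall>f\<in>Mor C X Y.
        at_mor M X Y f \<in> linear_maps k (at_obj M X) (at_obj M Y)) \<and>
     (\<forall>X\<in>Obj C. \<forall>x\<in>carrier (at_obj M X). at_mor M X X (Ident C X) x = x) \<and>
     (\<forall>X\<in>Obj C. \<forall>Y\<in>Obj C. \<forall>Z\<in>Obj C. \<forall>f\<in>Mor C X Y. \<forall>g\<in>Mor C Y Z.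
        \<forall>x\<in>carrier (at_obj M X).
          at_mor M X Z (Compos C X Y Z g f) x = at_mor M Y Z g (at_mor M X Y f x))"

definition is_csubmodule ::
    "('o, 'm) category \<Rightarrow> 'k ring \<Rightarrow> ('o, 'm, 'k, 'e) cmod \<Rightarrow> ('o \<Rightarrow> 'e set) \<Rightarrow> bool" where
  "is_csubmodule C k M N \<longleftrightarrow>
     (\<forall>X\<in>Obj C. submodule (N X) k (at_obj M X)) \<and>
     (\<forall>X\<in>Obj C. \<forall>Y\<in>Obj C. \<forall>f\<in>Mor C X Y. at_mor M X Y f ` N X \<subseteq> N Y)"

definition sub_cmod :: "('o, 'm, 'k, 'e) cmod \<Rightarrow> ('o \<Rightarrow> 'e set) \<Rightarrow> ('o, 'm, 'k, 'e) cmod" where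
  "sub_cmod M N = \<lparr>at_obj = (\<lambda>X. (at_obj M X)\<lparr>carrier := N X\<rparr>), at_mor = at_mor M\<rparr>"

definition cspan ::
    "('o, 'm) category \<Rightarrow> 'k ring \<Rightarrow> ('o, 'm, 'k, 'e) cmod \<Rightarrow> ('o \<times> 'e) set \<Rightarrow> 'o \<Rightarrow> 'e set" where
  "cspan C k M S X = \<Inter> {N X | N. is_csubmodule C k M N \<and> (\<forall>(Y, y)\<in>S. y \<in> N Y)}"

definition cmod_fin_gen ::
    "('o, 'm) category \<Rightarrow> 'k ring \<Rightarrow> ('o, 'm, 'k, 'e) cmod \<Rightarrow> bool" where
  "cmod_fin_gen C k M \<longleftrightarrow>
     (\<exists>S. finite S \<and> (\<forall>(Y, y)\<in>S. Y \<in> Obj C \<and> y \<in> carrier (at_obj M Y)) \<and>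
        (\<forall>X\<in>Obj C. cspan C k M S X = carrier (at_obj M X)))"

text \<open>
  Elements of modules are taken in the type \<open>(nat \<times> 'm \<Rightarrow> 'k) set\<close>. This loses no generality:
  a finitely generated module is a quotient of a finite direct sum of representables
  \<open>k[Mor C X\<^sub>i -]\<close>; elements of the sum are finitely supported functions
  \<open>nat \<times> 'm \<Rightarrow> 'k\<close>, and elements of the quotient are cosets, i.e. sets of such functions.
\<close>

definition locally_noetherian_over :: "('o, 'm) category \<Rightarrow> 'k ring \<Rightarrow> bool" where
  "locally_noetherian_over C k \<longleftrightarrow>
     (\<forall>(M :: ('o, 'm, 'k, (nat \<times> 'm \<Rightarrow> 'k) set) cmod) N.
        is_cmodule C k M \<and> cmod_fin_gen C k M \<and> is_csubmodule C k M N \<longrightarrow>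
        cmod_fin_gen C k (sub_cmod M N))"

text \<open>
  The coefficient rings range over all commutative Noetherian rings whose carrier is a
  subset of the type \<open>'k\<close>. If \<open>'k\<close> has only one element, then only the zero ring is covered and
  the property holds trivially.
\<close>

definition locally_noetherian :: "'k itself \<Rightarrow> ('o, 'm) category \<Rightarrow> bool" where
  "locally_noetherian K C \<longleftrightarrow>
     (\<forall>k :: 'k ring. cring k \<and> noetherian_ring k \<longrightarrow> locally_noetherian_over C k)"


section \<open>The categories VI, VIC and SI\<close>

text \<open>
  The objects are all finite-rank free modules with carrier in \<open>nat \<Rightarrow> 'r\<close>, a type that contains
  a copy of every \<open>R\<^sup>n\<close> (the functions in \<open>{..<n} \<rightarrow>\<^sub>E carrier R\<close>). The maps underlying morphisms are
  extensional, so that equality of morphisms is equality of maps on the carrier.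
\<close>

type_synonym 'r fmod = "('r, nat \<Rightarrow> 'r) module"
type_synonym 'r fmap = "(nat \<Rightarrow> 'r) \<Rightarrow> (nat \<Rightarrow> 'r)"

definition VI :: "'r ring \<Rightarrow> ('r fmod, 'r fmap) category" where
  "VI R = \<lparr>
     Obj = {V. finite_rank_free R V},
     Mor = (\<lambda>V W. {f \<in> linear_maps R V W \<inter> extensional (carrier V).
        inj_on f (carrier V) \<and>
        (\<exists>h\<in>linear_maps R W V. \<forall>v\<in>carrier V. h (f v) = v)}),
     Ident = (\<lambda>V. \<lambda>v\<in>carrier V. v),
     Compos = (\<lambda>U V W g f. compose (carrier U) g f)\<rparr>"

definition VIC :: "'r ring \<Rightarrow> ('r fmod, 'r fmap \<times> (nat \<Rightarrow> 'r) set) category" where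
  "VIC R = \<lparr>
     Obj = {V. finite_rank_free R V},
     Mor = (\<lambda>V W. {(f, C).
        f \<in> linear_maps R V W \<inter> extensional (carrier V) \<and> inj_on f (carrier V) \<and>
        submodule C R W \<and> free_module R (W\<lparr>carrier := C\<rparr>) \<and>
        f ` carrier V <+>\<^bsub>W\<^esub> C = carrier W \<and> f ` carrier V \<inter> C = {\<zero>\<^bsub>W\<^esub>}}),
     Ident = (\<lambda>V. (\<lambda>v\<in>carrier V. v, {\<zero>\<^bsub>V\<^esub>})),
     Compos = (\<lambda>U V W (g, D) (f, C). (compose (carrier U) g f, g ` C <+>\<^bsub>W\<^esub> D))\<rparr>"

definition bilinear_form :: "'r ring \<Rightarrow> ('r, 'v) module \<Rightarrow> ('v \<Rightarrow> 'v \<Rightarrow> 'r) \<Rightarrow> bool" where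
  "bilinear_form R V \<omega> \<longleftrightarrow>
     (\<forall>x\<in>carrier V. \<forall>y\<in>carrier V. \<omega> x y \<in> carrier R) \<and>
     (\<forall>x\<in>carrier V. \<forall>y\<in>carrier V. \<forall>z\<in>carrier V.
        \<omega> (x \<oplus>\<^bsub>V\<^esub> y) z = \<omega> x z \<oplus>\<^bsub>R\<^esub> \<omega> y z \<and> \<omega> z (x \<oplus>\<^bsub>V\<^esub> y) = \<omega> z x \<oplus>\<^bsub>R\<^esub> \<omega> z y) \<and>
     (\<forall>a\<in>carrier R. \<forall>x\<in>carrier V. \<forall>y\<in>carrier V.
        \<omega> (a \<odot>\<^bsub>V\<^esub> x) y = a \<otimes>\<^bsub>R\<^esub> \<omega> x y \<and> \<omega> x (a \<odot>\<^bsub>V\<^esub> y) = a \<otimes>\<^bsub>R\<^esub> \<omega> x y)"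

definition dual_space :: "'r ring \<Rightarrow> ('r, 'v) module \<Rightarrow> ('v \<Rightarrow> 'r) set" where
  "dual_space R V = {\<phi> \<in> carrier V \<rightarrow>\<^sub>E carrier R.
     (\<forall>x\<in>carrier V. \<forall>y\<in>carrier V. \<phi> (x \<oplus>\<^bsub>V\<^esub> y) = \<phi> x \<oplus>\<^bsub>R\<^esub> \<phi> y) \<and>
     (\<forall>a\<in>carrier R. \<forall>x\<in>carrier V. \<phi> (a \<odot>\<^bsub>V\<^esub> x) = a \<otimes>\<^bsub>R\<^esub> \<phi> x)}"

text \<open>
  The map \<open>V \<rightarrow> Hom\<^sub>R(V, R)\<close> induced by a bilinear form is automatically linear, so it is an
  isomorphism as soon as it is bijective.
\<close>

definition symplectic_form :: "'r ring \<Rightarrow> ('r, 'v) module \<Rightarrow> ('v \<Rightarrow> 'v \<Rightarrow> 'r) \<Rightarrow> bool" where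
  "symplectic_form R V \<omega> \<longleftrightarrow> bilinear_form R V \<omega> \<and>
     (\<forall>x\<in>carrier V. \<omega> x x = \<zero>\<^bsub>R\<^esub>) \<and>
     bij_betw (\<lambda>x. \<lambda>y\<in>carrier V. \<omega> x y) (carrier V) (dual_space R V)"

type_synonym 'r sform = "(nat \<Rightarrow> 'r) \<Rightarrow> (nat \<Rightarrow> 'r) \<Rightarrow> 'r"

definition SI :: "'r ring \<Rightarrow> ('r fmod \<times> 'r sform, 'r fmap) category" where
  "SI R = \<lparr>
     Obj = {(V, \<omega>). finite_rank_free R V \<and> symplectic_form R V \<omega>},
     Mor = (\<lambda>(V, \<omega>) (W, \<eta>). {f \<in> linear_maps R V W \<inter> extensional (carrier V).
        \<forall>x\<in>carrier V. \<forall>y\<in>carrier V. \<eta> (f x) (f y) = \<omega> x y}),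
     Ident = (\<lambda>(V, \<omega>). \<lambda>v\<in>carrier V. v),
     Compos = (\<lambda>(U, \<omega>) Y Z g f. compose (carrier U) g f)\<rparr>"

end

theory Submission
  imports Defs
begin

text \<open>
  Take the coefficient ring to be the field with two elements, so that the free module on a set is
  the set of its finite subsets under symmetric difference, and an injective map of sets acts on it
  by taking images. In each of the three categories every morphism has an underlying injective linear
  map, so \<open>X \<mapsto> X \<times> X\<close> is a functor to sets with injective transition maps. The
  linearisation of the subfunctor generated by the pair of basis vectors
  \<open>(e\<^sub>1, e\<^sub>2)\<close> of \<open>R\<^sup>2\<close> is a cyclic module \<open>M\<close>.

  Matrices act on pairs of vectors from the right, by
  \<open>(x, y) \<mapsto> (a x + c y, b x + d y)\<close>, and this commutes with all linear maps. Those of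
  determinant one preserve the generated subfunctor, because they are automorphisms of
  \<open>R\<^sup>2\<close> in all three categories. Given matrices
  \<open>s\<^sub>0, s\<^sub>1, \<dots>\<close> of determinant one, let \<open>N\<^sub>n\<close> be the submodule of
  \<open>M\<close> spanned by all \<open>{v, v s\<^sub>i}\<close> with \<open>i < n\<close>. The union \<open>N\<close> of this
  increasing chain is finitely generated only if \<open>N = N\<^sub>n\<close> for some \<open>n\<close>. To exclude
  this it suffices to find, for each \<open>n\<close>, a set \<open>K\<^sub>n\<close> of pairs at
  \<open>R\<^sup>2\<close> that is saturated for \<open>s\<^sub>0, \<dots>, s\<^sub>n\<^sub>-\<^sub>1\<close> and contains
  exactly one of \<open>v = (e\<^sub>1, e\<^sub>2)\<close> and \<open>v s\<^sub>n\<close>: every element of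
  \<open>N\<^sub>n\<close> meets \<open>K\<^sub>n\<close> in an even number of points, but
  \<open>{v, v s\<^sub>n}\<close> meets it in one. This reduction is the locale
  \<open>endo_sequence\<close>, whose conclusion is \<open>not_locally_noetherian\<close>.

  It remains to choose the matrices, which is lemma \<open>exists_separating_matrices\<close>; the sets
  \<open>K\<^sub>n\<close> only look at the first coordinates of the two vectors, that is, at the first row
  of a matrix. If the characteristic is positive, the additive group of the infinite ring
  \<open>R\<close> is a torsion group of bounded exponent, hence contains a strictly increasing sequence of
  finite subgroups, and elementary matrices do the job. In characteristic zero,
  \<open>SL\<^sub>2(\<int>)\<close> embeds into \<open>SL\<^sub>2(R)\<close>, and conjugates of the rotation by a quarter
  turn play ping-pong on the rows, so that none of them lies in the group generated by the preceding ones.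
\<close>

section \<open>Linearising a set-valued functor over the two-element field\<close>

text \<open>
  The coefficient type is only known to have two elements and carries no ring structure, so the
  field is built on two arbitrary elements of it.
\<close>

definition two_element_field :: "'k \<Rightarrow> 'k \<Rightarrow> 'k ring" where
  "two_element_field z e = \<lparr>carrier = {z, e}, mult = (\<lambda>x y. if x = e \<and> y = e then e else z),
     one = e, zero = z, add = (\<lambda>x y. if x = y then z else e)\<rparr>"

lemma cring_two_element_field:
  assumes "z \<noteq> e"
  shows "cring (two_element_field z e)"
  using assms by (intro cringI abelian_groupI comm_monoidI)
    (auto simp: two_element_field_def)

lemma noetherian_ring_if_finite:
  assumes "ring R" "finite (carrier R)"
  shows "noetherian_ring R"
proof -
  interpret ring R by fact
  show ?thesis
  proof
    fix I assume I: "ideal I R"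
    then have sub: "I \<subseteq> carrier R"
      by (simp add: additive_subgroup.a_subset ideal.axioms(1))
    moreover have "I = genideal R I"
      using genideal_minimal[OF I] genideal_self[OF sub] by blast
    ultimately show "\<exists>A\<subseteq>carrier R. finite A \<and> I = genideal R A"
      using assms(2) finite_subset by blast
  qed
qed

text \<open>
  For a family \<open>Z\<close> of finite sets this is a subspace of the free module over the field with
  two elements, a set standing for the sum of its elements. Allowing any family closed under
  symmetric difference covers the free modules and their submodules at once.
\<close>

definition set_module :: "'k ring \<Rightarrow> 'p set set \<Rightarrow> ('k, 'p set) module" where
  "set_module k Z = \<lparr>carrier = Z, mult = sym_diff, one = {}, zero = {}, add = sym_diff,
     smult = (\<lambda>c S. if c = \<one>\<^bsub>k\<^esub> then S else {})\<rparr>"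

definition sym_diff_closed :: "'p set set \<Rightarrow> bool" where
  "sym_diff_closed Z \<longleftrightarrow> {} \<in> Z \<and> (\<forall>S\<in>Z. \<forall>T\<in>Z. sym_diff S T \<in> Z)"

lemma module_set_module:
  assumes "z \<noteq> e" "sym_diff_closed Z"
  shows "module (two_element_field z e) (set_module (two_element_field z e) Z)"
  using assms
  by (intro moduleI cring_two_element_field abelian_groupI)
    (auto simp: set_module_def sym_diff_closed_def two_element_field_def)

lemma submodule_set_module:
  assumes "z \<noteq> e" "sym_diff_closed Z" "sym_diff_closed Z'" "Z' \<subseteq> Z"
  shows "submodule Z' (two_element_field z e) (set_module (two_element_field z e) Z)"
proof -
  let ?M = "set_module (two_element_field z e) Z"
  interpret M: module "two_element_field z e" ?M
    using assms by (intro module_set_module)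
  have inv: "\<ominus>\<^bsub>?M\<^esub> a = a" if "a \<in> Z" for a
    using that by (intro M.minus_equality) (auto simp: set_module_def)
  show ?thesis
    using assms inv by (intro M.submoduleI) (auto simp: sym_diff_closed_def set_module_def)
qed

lemma sym_diff_closed_if_submodule:
  assumes "submodule Z' k (set_module k Z)"
  shows "sym_diff_closed Z'"
proof -
  interpret submodule Z' k "set_module k Z" by fact
  show ?thesis
    using one_closed m_closed unfolding sym_diff_closed_def set_module_def by simp
qed

text \<open>
  The linear span of the sums \<open>u + v\<close> over the edges \<open>(u, v)\<close> of a graph. The condition
  \<open>u \<noteq> v\<close> is there because \<open>u + u = 0\<close>, while the set \<open>{u, v}\<close> is a singleton for
  \<open>u = v\<close>.
\<close>

inductive_set pair_span :: "('p \<times> 'p) set \<Rightarrow> 'p set set" for E where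
  empty: "{} \<in> pair_span E"
| toggle: "S \<in> pair_span E \<Longrightarrow> (u, v) \<in> E \<Longrightarrow> u \<noteq> v \<Longrightarrow> sym_diff S {u, v} \<in> pair_span E"

lemma pair_span_sym_diff:
  assumes "S \<in> pair_span E" "T \<in> pair_span E"
  shows "sym_diff S T \<in> pair_span E"
  using assms(2)
proof induction
  case (toggle T u v)
  have "sym_diff S (sym_diff T {u, v}) = sym_diff (sym_diff S T) {u, v}" by blast
  then show ?case using toggle pair_span.toggle by metis
qed (use assms(1) in simp)

lemma sym_diff_closed_pair_span: "sym_diff_closed (pair_span E)"
  by (simp add: sym_diff_closed_def pair_span.empty pair_span_sym_diff)

lemma pair_span_mono:
  assumes "E \<subseteq> E'"
  shows "pair_span E \<subseteq> pair_span E'"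
proof
  fix S assume "S \<in> pair_span E"
  then show "S \<in> pair_span E'"
    by induction (use assms in \<open>auto intro: pair_span.intros\<close>)
qed

lemma pair_in_pair_span:
  assumes "(u, v) \<in> E" "u \<noteq> v"
  shows "{u, v} \<in> pair_span E"
  using pair_span.toggle[OF pair_span.empty assms] by simp

lemma finite_subset_of_pair_span:
  assumes "S \<in> pair_span E" "E \<subseteq> X \<times> X"
  shows "finite S \<and> S \<subseteq> X"
  using assms by induction auto

lemma image_sym_diff:
  assumes "inj_on f X" "S \<subseteq> X" "T \<subseteq> X"
  shows "f ` sym_diff S T = sym_diff (f ` S) (f ` T)"
proof -
  have "f ` (S - T) = f ` S - f ` T" "f ` (T - S) = f ` T - f ` S"
    using assms by (meson inj_on_image_set_diff Diff_subset subset_trans)+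
  then show ?thesis by (simp add: image_Un)
qed

lemma image_pair_span:
  assumes "S \<in> pair_span E" "E \<subseteq> X \<times> X" "inj_on f X"
    and "\<And>u v. (u, v) \<in> E \<Longrightarrow> (f u, f v) \<in> E'"
  shows "f ` S \<in> pair_span E'"
  using assms(1)
proof induction
  case (toggle S u v)
  have uv: "u \<in> X" "v \<in> X" using toggle assms(2) by auto
  have "f ` sym_diff S {u, v} = sym_diff (f ` S) {f u, f v}"
    using image_sym_diff[OF assms(3), of S "{u, v}"] uv finite_subset_of_pair_span[OF toggle(1) assms(2)]
    by simp
  moreover have "f u \<noteq> f v" using uv toggle assms(3) by (meson inj_onD)
  ultimately show ?case using toggle assms(4) pair_span.toggle by metis
qed (simp add: pair_span.empty)

lemma even_card_sym_diff:
  assumes "finite S" "finite T"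
  shows "even (card (sym_diff S T)) \<longleftrightarrow> (even (card S) \<longleftrightarrow> even (card T))"
proof -
  have "card (sym_diff S T) = card (S - T) + card (T - S)"
    using assms by (intro card_Un_disjoint) auto
  moreover have "card S = card (S - T) + card (S \<inter> T)" "card T = card (T - S) + card (S \<inter> T)"
    using assms card_Int_Diff[of S T] card_Int_Diff[of T S] by (simp_all add: Int_commute)
  ultimately show ?thesis by presburger
qed

text \<open>
  Counting the elements in \<open>K\<close> modulo two is a linear functional, and it vanishes on
  \<open>u + v\<close> when \<open>K\<close> contains both ends of an edge or neither. This is the only obstruction used
  to show that an element lies outside a span.
\<close>

lemma even_card_pair_span:
  assumes "S \<in> pair_span E" "\<And>u v. (u, v) \<in> E \<Longrightarrow> u \<in> K \<longleftrightarrow> v \<in> K"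
  shows "even (card (S \<inter> K))"
  using assms(1)
proof induction
  case (toggle S u v)
  have fin: "finite S"
    using finite_subset_of_pair_span[OF toggle(1), of UNIV] by simp
  have "sym_diff S {u, v} \<inter> K = sym_diff (S \<inter> K) ({u, v} \<inter> K)" by blast
  moreover have "even (card ({u, v} \<inter> K))"
    using assms(2)[OF toggle(2)] toggle(3) by (cases "u \<in> K") (auto simp: Int_absorb2)
  ultimately show ?case
    using toggle fin even_card_sym_diff[of "S \<inter> K" "{u, v} \<inter> K"] by simp
qed simp

text \<open>
  The set-theoretic input. \<open>G\<close> is a functor to sets with injective transition maps
  \<open>act\<close>, and the \<open>\<tau> i\<close> are natural endomorphisms of it which on the base point
  \<open>x0\<close> agree with endomorphisms \<open>s i\<close> of the object \<open>A\<close>. The sets \<open>K n\<close> witness that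
  \<open>\<tau> n\<close> moves \<open>x0\<close> to a point that cannot be reached by moving back and forth along
  \<open>\<tau> 0, \<dots>, \<tau> (n - 1)\<close>.
\<close>

locale endo_sequence =
  fixes C :: "('o, 'm) category" and G :: "'o \<Rightarrow> 'p set" and act :: "'m \<Rightarrow> 'p \<Rightarrow> 'p"
    and A :: 'o and x0 :: 'p and s :: "nat \<Rightarrow> 'm"
    and \<tau> :: "nat \<Rightarrow> 'o \<Rightarrow> 'p \<Rightarrow> 'p" and K :: "nat \<Rightarrow> 'p set"
  assumes act_in: "\<lbrakk>X \<in> Obj C; Y \<in> Obj C; f \<in> Mor C X Y; v \<in> G X\<rbrakk> \<Longrightarrow> act f v \<in> G Y"
    and act_inj: "\<lbrakk>X \<in> Obj C; Y \<in> Obj C; f \<in> Mor C X Y\<rbrakk> \<Longrightarrow> inj_on (act f) (G X)"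
    and act_ident: "\<lbrakk>X \<in> Obj C; v \<in> G X\<rbrakk> \<Longrightarrow> act (Ident C X) v = v"
    and act_compos: "\<lbrakk>X \<in> Obj C; Y \<in> Obj C; Z \<in> Obj C; f \<in> Mor C X Y; g \<in> Mor C Y Z; v \<in> G X\<rbrakk>
      \<Longrightarrow> act (Compos C X Y Z g f) v = act g (act f v)"
    and A_obj: "A \<in> Obj C" and x0_in: "x0 \<in> G A" and s_mor: "s i \<in> Mor C A A"
    and \<tau>_natural: "\<lbrakk>X \<in> Obj C; Y \<in> Obj C; f \<in> Mor C X Y; v \<in> G X\<rbrakk>
      \<Longrightarrow> \<tau> i Y (act f v) = act f (\<tau> i X v)"
    and \<tau>_x0: "\<tau> i A x0 = act (s i) x0"
    and K_saturated: "\<lbrakk>i < n; v \<in> G A\<rbrakk> \<Longrightarrow> \<tau> i A v \<in> K n \<longleftrightarrow> v \<in> K n"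
    and x0_in_K: "x0 \<in> K n" and \<tau>_x0_notin_K: "\<tau> n A x0 \<notin> K n"
begin

text \<open>
  The subfunctor generated by \<open>x0\<close>. It consists of the images of \<open>x0\<close> under chains of morphisms
  rather than under single ones, and so is closed under the action by construction. With single
  morphisms this would rest on their closure under composition, hence for VIC on the freeness of
  the sum of two free complements.
\<close>

inductive_set orbit :: "('o \<times> 'p) set" where
  base: "(A, x0) \<in> orbit"
| move: "(X, v) \<in> orbit \<Longrightarrow> X \<in> Obj C \<Longrightarrow> Y \<in> Obj C \<Longrightarrow> f \<in> Mor C X Y \<Longrightarrow> (Y, act f v) \<in> orbit"

definition gen :: "'o \<Rightarrow> 'p set" where
  "gen X = orbit `` {X}"

lemma orbit_in: "(X, v) \<in> orbit \<Longrightarrow> X \<in> Obj C \<and> v \<in> G X"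
  by (induction rule: orbit.induct) (auto simp: A_obj x0_in act_in)

lemma gen_subset: "gen X \<subseteq> G X"
  using orbit_in by (auto simp: gen_def)

lemma act_gen: "\<lbrakk>X \<in> Obj C; Y \<in> Obj C; f \<in> Mor C X Y; v \<in> gen X\<rbrakk> \<Longrightarrow> act f v \<in> gen Y"
  by (auto simp: gen_def intro: orbit.move)

text \<open>
  At the base point \<open>\<tau> i\<close> is the action of a morphism, and naturality carries this along the
  orbit.
\<close>

lemma \<tau>_orbit: "(X, v) \<in> orbit \<Longrightarrow> (X, \<tau> i X v) \<in> orbit"
proof (induction rule: orbit.induct)
  case base
  then show ?case using orbit.move[OF orbit.base A_obj A_obj s_mor] by (simp add: \<tau>_x0)
next
  case (move X v Y f)
  then show ?case using orbit.move[of X "\<tau> i X v" Y f] orbit_in[of X v] \<tau>_natural[of X Y f v] by simp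
qed

definition edges :: "nat \<Rightarrow> 'o \<Rightarrow> ('p \<times> 'p) set" where
  "edges n X = {(v, \<tau> i X v) | i v. i < n \<and> v \<in> gen X}"

lemma edges_subset: "edges n X \<subseteq> gen X \<times> gen X"
  using \<tau>_orbit by (auto simp: edges_def gen_def)

lemma edges_mono: "m \<le> n \<Longrightarrow> edges m X \<subseteq> edges n X"
  unfolding edges_def using less_le_trans by blast

lemma act_edges:
  assumes "X \<in> Obj C" "Y \<in> Obj C" "f \<in> Mor C X Y" "(u, v) \<in> edges n X"
  shows "(act f u, act f v) \<in> edges n Y"
proof -
  obtain i where i: "i < n" "u \<in> gen X" "v = \<tau> i X u"
    using assms(4) by (auto simp: edges_def)
  then have "act f v = \<tau> i Y (act f u)"
    using \<tau>_natural assms gen_subset by (metis subsetD)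
  then show ?thesis
    using i act_gen assms by (auto simp: edges_def)
qed

text \<open>
  The chain of submodules \<open>level 0 \<subseteq> level 1 \<subseteq> \<dots>\<close> of the linearisation \<open>lin\<close>, with
  union \<open>sub\<close>.
\<close>

definition level :: "nat \<Rightarrow> 'o \<Rightarrow> 'p set set" where
  "level n X = pair_span (edges n X)"

definition sub :: "'o \<Rightarrow> 'p set set" where
  "sub X = (\<Union>n. level n X)"

definition fin_sets :: "'o \<Rightarrow> 'p set set" where
  "fin_sets X = {S. finite S \<and> S \<subseteq> gen X}"

definition lin :: "'k ring \<Rightarrow> ('o, 'm, 'k, 'p set) cmod" where
  "lin k = \<lparr>at_obj = (\<lambda>X. set_module k (fin_sets X)), at_mor = (\<lambda>X Y f S. act f ` S)\<rparr>"

lemma sym_diff_closed_fin_sets: "sym_diff_closed (fin_sets X)"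
  by (auto simp: sym_diff_closed_def fin_sets_def)

lemma level_mono: "m \<le> n \<Longrightarrow> level m X \<subseteq> level n X"
  by (simp add: level_def pair_span_mono edges_mono)

lemma sub_subset: "sub X \<subseteq> fin_sets X"
  using finite_subset_of_pair_span[OF _ edges_subset]
  by (auto simp: sub_def fin_sets_def level_def)

lemma sym_diff_closed_sub: "sym_diff_closed (sub X)"
  unfolding sym_diff_closed_def
proof (intro conjI ballI)
  show "{} \<in> sub X" by (simp add: sub_def level_def pair_span.empty)
  fix S T assume "S \<in> sub X" "T \<in> sub X"
  then obtain m n where "S \<in> level m X" "T \<in> level n X" by (auto simp: sub_def)
  then have "S \<in> level (max m n) X" "T \<in> level (max m n) X"
    using level_mono[of m "max m n"] level_mono[of n "max m n"] by auto
  then show "sym_diff S T \<in> sub X"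
    unfolding sub_def level_def using pair_span_sym_diff by blast
qed

lemma act_level:
  assumes "X \<in> Obj C" "Y \<in> Obj C" "f \<in> Mor C X Y" "S \<in> level n X"
  shows "act f ` S \<in> level n Y"
  unfolding level_def
proof (rule image_pair_span)
  show "S \<in> pair_span (edges n X)" using assms by (simp add: level_def)
  show "inj_on (act f) (gen X)" using act_inj assms gen_subset by (meson inj_on_subset)
qed (use edges_subset act_edges assms in auto)

lemma lin_is_cmodule:
  assumes "z \<noteq> e"
  shows "is_cmodule C (two_element_field z e) (lin (two_element_field z e))"
  unfolding is_cmodule_def
proof (intro conjI ballI)
  fix X assume X: "X \<in> Obj C"
  show "module (two_element_field z e) (at_obj (lin (two_element_field z e)) X)"
    using assms by (simp add: lin_def module_set_module sym_diff_closed_fin_sets)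
next
  fix X Y f assume XYf: "X \<in> Obj C" "Y \<in> Obj C" "f \<in> Mor C X Y"
  have inj: "inj_on (act f) (gen X)" using act_inj XYf gen_subset by (meson inj_on_subset)
  show "at_mor (lin (two_element_field z e)) X Y f
    \<in> linear_maps (two_element_field z e) (at_obj (lin (two_element_field z e)) X)
        (at_obj (lin (two_element_field z e)) Y)"
    using image_sym_diff[OF inj] act_gen XYf
    by (auto simp: lin_def linear_maps_def set_module_def fin_sets_def)
next
  fix X x assume "X \<in> Obj C" "x \<in> carrier (at_obj (lin (two_element_field z e)) X)"
  then show "at_mor (lin (two_element_field z e)) X X (Ident C X) x = x"
    using act_ident gen_subset by (force simp: lin_def set_module_def fin_sets_def)
next
  fix X Y Z f g x assume "X \<in> Obj C" "Y \<in> Obj C" "Z \<in> Obj C" "f \<in> Mor C X Y" "g \<in> Mor C Y Z"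
    "x \<in> carrier (at_obj (lin (two_element_field z e)) X)"
  then show "at_mor (lin (two_element_field z e)) X Z (Compos C X Y Z g f) x =
    at_mor (lin (two_element_field z e)) Y Z g (at_mor (lin (two_element_field z e)) X Y f x)"
    using act_compos gen_subset[of X]
    by (auto simp: lin_def set_module_def fin_sets_def image_image intro!: image_cong)
qed

text \<open>
  The element \<open>{x0}\<close> generates: a submodule containing it contains the singletons of all orbit
  points, and these span.
\<close>

lemma lin_fin_gen:
  assumes "z \<noteq> e"
  shows "cmod_fin_gen C (two_element_field z e) (lin (two_element_field z e))"
proof -
  let ?k = "two_element_field z e"
  have full: "is_csubmodule C ?k (lin ?k) fin_sets"
    using assms act_gen
    by (auto simp: is_csubmodule_def lin_def submodule_set_module sym_diff_closed_fin_sets)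
       (auto simp: fin_sets_def)
  have x0: "{x0} \<in> fin_sets A"
    by (simp add: fin_sets_def gen_def orbit.base)
  have "cspan C ?k (lin ?k) {(A, {x0})} X = fin_sets X" if X: "X \<in> Obj C" for X
  proof
    show "cspan C ?k (lin ?k) {(A, {x0})} X \<subseteq> fin_sets X"
      unfolding cspan_def using full x0 by blast
  next
    have "fin_sets X \<subseteq> N X"
      if N: "is_csubmodule C ?k (lin ?k) N" and x0N: "{x0} \<in> N A" for N
    proof -
      have single: "{v} \<in> N X" if "(X, v) \<in> orbit" for X v
        using that
      proof (induction rule: orbit.induct)
        case (move X v Y f)
        then have "at_mor (lin ?k) X Y f ` N X \<subseteq> N Y"
          using N by (simp add: is_csubmodule_def)
        then show ?case using move by (force simp: lin_def)
      qed (rule x0N)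
      have closed: "sym_diff_closed (N X)"
        using N X by (auto simp: is_csubmodule_def lin_def intro: sym_diff_closed_if_submodule)
      have "S \<in> N X" if "finite S" "S \<subseteq> gen X" for S
        using that
      proof (induction S rule: finite_induct)
        case empty
        then show ?case using closed by (simp add: sym_diff_closed_def)
      next
        case (insert v S)
        then have "{v} \<in> N X" using single by (auto simp: gen_def)
        moreover have "insert v S = sym_diff S {v}" using insert by blast
        moreover have "S \<in> N X" using insert by simp
        ultimately show ?case using closed unfolding sym_diff_closed_def by metis
      qed
      then show ?thesis by (auto simp: fin_sets_def)
    qed
    then show "fin_sets X \<subseteq> cspan C ?k (lin ?k) {(A, {x0})} X"
      unfolding cspan_def by auto
  qed
  then show ?thesis
    unfolding cmod_fin_gen_def using A_obj x0
    by (intro exI[of _ "{(A, {x0})}"]) (auto simp: lin_def set_module_def)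
qed

lemma sub_is_csubmodule:
  assumes "z \<noteq> e"
  shows "is_csubmodule C (two_element_field z e) (lin (two_element_field z e)) sub"
  unfolding is_csubmodule_def
proof (intro conjI ballI)
  fix X show "submodule (sub X) (two_element_field z e) (at_obj (lin (two_element_field z e)) X)"
    using assms by (simp add: lin_def sub_subset submodule_set_module
        sym_diff_closed_fin_sets sym_diff_closed_sub)
next
  fix X Y f assume "X \<in> Obj C" "Y \<in> Obj C" "f \<in> Mor C X Y"
  then show "at_mor (lin (two_element_field z e)) X Y f ` sub X \<subseteq> sub Y"
    using act_level[of X Y f] by (auto simp: lin_def sub_def)
qed

text \<open>
  The pair \<open>{x0, \<tau> n A x0}\<close> belongs to level \<open>n + 1\<close>. It is not in level \<open>n\<close>, since it meets
  \<open>K n\<close> in exactly one point.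
\<close>

lemma sub_ne_level: "\<not> sub A \<subseteq> level n A"
proof
  assume sub: "sub A \<subseteq> level n A"
  let ?v = "\<tau> n A x0"
  have ne: "x0 \<noteq> ?v" using x0_in_K \<tau>_x0_notin_K by metis
  have "(x0, ?v) \<in> edges (Suc n) A"
    by (auto simp: edges_def gen_def orbit.base)
  then have "{x0, ?v} \<in> level n A"
    using sub pair_in_pair_span[OF _ ne] unfolding sub_def level_def by blast
  moreover have "u \<in> K n \<longleftrightarrow> v \<in> K n" if "(u, v) \<in> edges n A" for u v
    using that K_saturated subsetD[OF gen_subset] unfolding edges_def by blast
  ultimately have "even (card ({x0, ?v} \<inter> K n))"
    unfolding level_def by (intro even_card_pair_span)
  moreover have "{x0, ?v} \<inter> K n = {x0}" using x0_in_K \<tau>_x0_notin_K by auto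
  ultimately show False by simp
qed

text \<open>
  Finitely many elements of the union of a chain lie in one member of the chain, which would then
  be the whole union.
\<close>

lemma sub_not_fin_gen:
  assumes "z \<noteq> e"
  shows "\<not> cmod_fin_gen C (two_element_field z e) (sub_cmod (lin (two_element_field z e)) sub)"
proof
  let ?k = "two_element_field z e"
  let ?N = "sub_cmod (lin ?k) sub"
  assume "cmod_fin_gen C ?k ?N"
  then obtain S where S: "finite S" "\<And>Y y. (Y, y) \<in> S \<Longrightarrow> Y \<in> Obj C \<and> y \<in> sub Y"
    "\<And>X. X \<in> Obj C \<Longrightarrow> cspan C ?k ?N S X = sub X"
    unfolding cmod_fin_gen_def sub_cmod_def by (auto 4 4)
  have "\<exists>n. \<forall>(Y, y)\<in>S'. y \<in> level n Y" if "finite S'" "S' \<subseteq> S" for S'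
    using that
  proof (induction S' rule: finite_induct)
    case (insert p S')
    obtain Y y where p: "p = (Y, y)" by (cases p)
    obtain m where m: "y \<in> level m Y" using insert S(2)[of Y y] p unfolding sub_def by blast
    obtain n where n: "\<forall>(Y, y)\<in>S'. y \<in> level n Y" using insert by auto
    have "\<forall>(Y, y)\<in>insert p S'. y \<in> level (max m n) Y"
      using m n p level_mono[of m "max m n"] level_mono[of n "max m n"] by fastforce
    then show ?case by blast
  qed simp
  then obtain n where n: "\<forall>(Y, y)\<in>S. y \<in> level n Y" using S(1) by blast
  have eq: "(set_module ?k (fin_sets X))\<lparr>carrier := sub X\<rparr> = set_module ?k (sub X)" for X
    by (simp add: set_module_def)
  have "is_csubmodule C ?k ?N (level n)"
    unfolding is_csubmodule_def
  proof (intro conjI ballI)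
    fix X show "submodule (level n X) ?k (at_obj ?N X)"
      using submodule_set_module[OF assms sym_diff_closed_sub, of "level n X" X]
        sym_diff_closed_pair_span[of "edges n X"]
      by (simp add: sub_cmod_def lin_def eq UN_upper sub_def[symmetric] level_def[symmetric])
         (auto simp: sub_def)
  next
    fix X Y f assume "X \<in> Obj C" "Y \<in> Obj C" "f \<in> Mor C X Y"
    then show "at_mor ?N X Y f ` level n X \<subseteq> level n Y"
      using act_level[of X Y f] by (auto simp: sub_cmod_def lin_def)
  qed
  then have "cspan C ?k ?N S A \<subseteq> level n A"
    unfolding cspan_def using n by blast
  then show False using S(3)[OF A_obj] sub_ne_level by blast
qed

text \<open>
  Elements of the modules in question are sets of functions \<open>nat \<times> 'm \<Rightarrow> 'k\<close>. The points of
  the functor can therefore be replaced by such functions, once they embed into them.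
\<close>

lemma transport:
  assumes "inj \<iota>"
  shows "endo_sequence C (\<lambda>X. \<iota> ` G X) (\<lambda>f. \<iota> \<circ> act f \<circ> inv_into UNIV \<iota>) A (\<iota> x0) s
    (\<lambda>i X. \<iota> \<circ> \<tau> i X \<circ> inv_into UNIV \<iota>) (\<lambda>n. \<iota> ` K n)"
proof (unfold_locales, goal_cases)
  case (2 X Y f)
  show ?case
    using act_inj[OF 2] assms by (auto simp: inj_on_def)
next
  case (10 i n v)
  then show ?case using assms K_saturated by (auto simp: inj_image_mem_iff inj_eq)
qed (use assms in \<open>auto simp: act_in act_ident act_compos A_obj x0_in s_mor \<tau>_natural
      x0_in_K \<tau>_x0_notin_K inj_image_mem_iff simp flip: \<tau>_x0\<close>)

end

lemma (in endo_sequence) not_locally_noetherian: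
  fixes \<iota> :: "'p \<Rightarrow> 'm"
  assumes "inj \<iota>" and "\<exists>a b :: 'k. a \<noteq> b"
  shows "\<not> locally_noetherian TYPE('k) C"
proof -
  obtain z e :: 'k where ze: "z \<noteq> e" using assms(2) by blast
  \<comment> \<open>A point is encoded as the indicator function of its image, using two values of \<open>'k\<close>.\<close>
  define \<kappa> :: "'p \<Rightarrow> (nat \<times> 'm \<Rightarrow> 'k)" where "\<kappa> p = (\<lambda>(i, m). if m = \<iota> p then e else z)" for p
  have "inj \<kappa>"
  proof (rule injI)
    fix p q assume "\<kappa> p = \<kappa> q"
    then have "\<kappa> q (0, \<iota> p) = \<kappa> p (0, \<iota> p)" by simp
    then have "\<iota> p = \<iota> q" using ze by (auto simp: \<kappa>_def split: if_splits)
    then show "p = q" using assms(1) by (simp add: inj_eq)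
  qed
  then interpret T: endo_sequence C "\<lambda>X. \<kappa> ` G X" "\<lambda>f. \<kappa> \<circ> act f \<circ> inv_into UNIV \<kappa>" A "\<kappa> x0" s
    "\<lambda>i X. \<kappa> \<circ> \<tau> i X \<circ> inv_into UNIV \<kappa>" "\<lambda>n. \<kappa> ` K n"
    by (rule transport)
  have cr: "cring (two_element_field z e)" by (rule cring_two_element_field[OF ze])
  then have "noetherian_ring (two_element_field z e)"
    by (intro noetherian_ring_if_finite) (auto simp: cring.axioms two_element_field_def)
  moreover have "\<not> locally_noetherian_over C (two_element_field z e)"
    unfolding locally_noetherian_over_def
    using T.lin_is_cmodule[OF ze] T.lin_fin_gen[OF ze] T.sub_is_csubmodule[OF ze]
      T.sub_not_fin_gen[OF ze] by blast
  ultimately show ?thesis using cr by (auto simp: locally_noetherian_def)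
qed

section \<open>Sequences of unimodular matrices\<close>

text \<open>
  The matrices are \<open>((a, b), (c, d))\<close> of determinant one, acting on rows from the right. The
  orbit of the row \<open>(1, 0)\<close> under the group generated by the first \<open>n\<close> of them stays in
  \<open>P n\<close>, and the next matrix moves it out of \<open>P n\<close>.
\<close>

definition (in cring) separating_matrices ::
    "(nat \<Rightarrow> 'a) \<Rightarrow> (nat \<Rightarrow> 'a) \<Rightarrow> (nat \<Rightarrow> 'a) \<Rightarrow> (nat \<Rightarrow> 'a) \<Rightarrow> (nat \<Rightarrow> ('a \<times> 'a) set) \<Rightarrow> bool" where
  "separating_matrices a b c d P \<longleftrightarrow>
     (\<forall>n. a n \<in> carrier R \<and> b n \<in> carrier R \<and> c n \<in> carrier R \<and> d n \<in> carrier R) \<and>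
     (\<forall>n. a n \<otimes> d n \<ominus> b n \<otimes> c n = \<one>) \<and>
     (\<forall>n. (\<one>, \<zero>) \<in> P n \<and> (a n, b n) \<notin> P n) \<and>
     (\<forall>n. \<forall>i<n. \<forall>p\<in>carrier R. \<forall>q\<in>carrier R.
        (a i \<otimes> p \<oplus> c i \<otimes> q, b i \<otimes> p \<oplus> d i \<otimes> q) \<in> P n \<longleftrightarrow> (p, q) \<in> P n)"

subsection \<open>Positive characteristic\<close>

text \<open>
  Adjoin the multiples of any \<open>r\<close> outside \<open>K\<close>; there are at most \<open>m\<close> of them.
\<close>

lemma (in cring) larger_finite_subgroup:
  assumes m: "m > 0" "[(m::nat)] \<cdot> \<one> = \<zero>" and inf: "infinite (carrier R)"
    and K: "subgroup K (add_monoid R)" "finite K"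
  shows "\<exists>K'. subgroup K' (add_monoid R) \<and> finite K' \<and> K \<subset> K'"
proof -
  interpret K: subgroup K "add_monoid R" by fact
  obtain r where r: "r \<in> carrier R" "r \<notin> K"
    using inf K(2) by (meson finite_subset subsetI)
  define K' where "K' = {k \<oplus> [(j::int)] \<cdot> r | k j. k \<in> K}"
  have Kc: "k \<in> carrier R" if "k \<in> K" for k using that K.mem_carrier by simp
  have "[int m] \<cdot> r = [m] \<cdot> (\<one> \<otimes> r)"
    using r by (simp add: add_pow_int_ge)
  also have "\<dots> = \<zero>" using m(2) r add_pow_ldistr[of \<one> r m] by simp
  finally have mr: "[int m] \<cdot> r = \<zero>" .
  have period: "[j] \<cdot> r = [(j mod int m)] \<cdot> r" for j
  proof -
    have "[j] \<cdot> r = [(int m * (j div int m))] \<cdot> r \<oplus> [(j mod int m)] \<cdot> r"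
      using add.int_pow_mult[OF r(1), of "int m * (j div int m)" "j mod int m"] by simp
    also have "[(int m * (j div int m))] \<cdot> r = [(j div int m)] \<cdot> ([int m] \<cdot> r)"
      using add.int_pow_pow[OF r(1)] by (simp add: mult.commute)
    finally show ?thesis using r mr by (simp add: add.int_pow_one add.int_pow_closed)
  qed
  have "K' \<subseteq> (\<lambda>(k, j). k \<oplus> [j] \<cdot> r) ` (K \<times> {0..<int m})"
  proof
    fix x assume "x \<in> K'"
    then obtain k j where "k \<in> K" "x = k \<oplus> [(j::int)] \<cdot> r" by (auto simp: K'_def)
    then show "x \<in> (\<lambda>(k, j). k \<oplus> [j] \<cdot> r) ` (K \<times> {0..<int m})"
      using period[of j] m(1) by (intro image_eqI[of _ _ "(k, j mod int m)"]) auto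
  qed
  then have fin: "finite K'" using K(2) finite_subset by blast
  have "subgroup K' (add_monoid R)"
  proof (rule add.subgroupI)
    show "K' \<subseteq> carrier R" using r Kc by (auto simp: K'_def add.int_pow_closed)
    show "K' \<noteq> {}" using K.one_closed by (auto simp: K'_def)
  next
    fix x assume "x \<in> K'"
    then obtain k j where "k \<in> K" "x = k \<oplus> [(j::int)] \<cdot> r" by (auto simp: K'_def)
    moreover from this have "\<ominus> x = \<ominus> k \<oplus> [(- j)] \<cdot> r"
      using r Kc by (simp add: add.int_pow_neg minus_add add.int_pow_closed)
    moreover have "\<ominus> k \<in> K" using K.m_inv_closed[OF \<open>k \<in> K\<close>] by (simp add: a_inv_def)
    ultimately show "\<ominus> x \<in> K'" by (auto simp: K'_def)
  next
    fix x y assume "x \<in> K'" "y \<in> K'"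
    then obtain k j k' j' where kj: "k \<in> K" "x = k \<oplus> [(j::int)] \<cdot> r"
      "k' \<in> K" "y = k' \<oplus> [(j'::int)] \<cdot> r" by (auto simp: K'_def)
    then have "x \<oplus> y = (k \<oplus> k') \<oplus> [(j + j')] \<cdot> r"
      using r Kc by (simp add: add.int_pow_mult add.int_pow_closed a_ac)
    moreover have "k \<oplus> k' \<in> K" using K.m_closed kj by simp
    ultimately show "x \<oplus> y \<in> K'" by (auto simp: K'_def)
  qed
  moreover have "K \<subseteq> K'"
  proof
    fix k assume "k \<in> K"
    moreover from this have "k = k \<oplus> [(0::int)] \<cdot> r" using Kc by (simp add: add_pow_int_ge)
    ultimately show "k \<in> K'" unfolding K'_def by blast
  qed
  moreover have "r \<in> K'"
  proof -
    have "r = \<zero> \<oplus> [(1::int)] \<cdot> r" using r by (simp add: add_pow_int_ge)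
    moreover have "\<zero> \<in> K" using K.one_closed by simp
    ultimately show ?thesis unfolding K'_def by blast
  qed
  ultimately show ?thesis using fin r by blast
qed

text \<open>
  With a strictly increasing sequence of finite additive subgroups \<open>K n\<close> and \<open>r n\<close> in
  \<open>K (n + 1)\<close> but not in \<open>K n\<close>, the elementary matrix with entry \<open>r n\<close> maps \<open>(1, k)\<close> to
  \<open>(1, r n + k)\<close>.
\<close>

lemma (in cring) separating_matrices_positive_char:
  assumes "m > 0" "[(m::nat)] \<cdot> \<one> = \<zero>" "infinite (carrier R)"
  shows "\<exists>a b c d P. separating_matrices a b c d P"
proof -
  define S where "S = (\<lambda>K. subgroup K (add_monoid R) \<and> finite K)"
  have "S {\<zero>}" using add.triv_subgroup by (simp add: S_def)
  then obtain K where K: "\<And>n. S (K n)" "\<And>n. K n \<subset> K (Suc n)"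
    using dependent_nat_choice[of "\<lambda>_. S" "\<lambda>_. (\<subset>)"] larger_finite_subgroup[OF assms]
    unfolding S_def by metis
  have "\<forall>n. \<exists>r. r \<in> K (Suc n) \<and> r \<notin> K n" using K(2) by blast
  then obtain r where r: "\<And>n. r n \<in> K (Suc n)" "\<And>n. r n \<notin> K n" by metis
  have sub: "subgroup (K n) (add_monoid R)" for n using K(1) by (simp add: S_def)
  have Kc: "K n \<subseteq> carrier R" for n using subgroup.subset[OF sub] by simp
  then have rc: "r n \<in> carrier R" for n using r(1) by blast
  have r_in: "r i \<in> K n" if "i < n" for i n
  proof -
    have "K m \<subseteq> K (Suc m)" for m using K(2)[of m] by (rule psubset_imp_subset)
    from lift_Suc_mono_le[of K, OF this Suc_leI[OF that]] have "K (Suc i) \<subseteq> K n" .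
    then show ?thesis using r(1)[of i] by blast
  qed
  have sat: "r i \<oplus> q \<in> K n \<longleftrightarrow> q \<in> K n" if "i < n" "q \<in> carrier R" for i n q
  proof
    assume "r i \<oplus> q \<in> K n"
    then have "\<ominus> r i \<oplus> (r i \<oplus> q) \<in> K n"
      using subgroup.m_closed[OF sub] subgroup.m_inv_closed[OF sub r_in[OF that(1)]]
      by (simp add: a_inv_def)
    then show "q \<in> K n" using rc that by (simp add: r_neg1)
  next
    assume "q \<in> K n"
    then show "r i \<oplus> q \<in> K n" using subgroup.m_closed[OF sub r_in[OF that(1)]] by simp
  qed
  have zero: "\<zero> \<in> K n" for n using subgroup.one_closed[OF sub] by simp
  have "separating_matrices (\<lambda>_. \<one>) r (\<lambda>_. \<zero>) (\<lambda>_. \<one>) (\<lambda>n. {\<one>} \<times> K n)"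
    unfolding separating_matrices_def
    using rc r zero sat by (auto simp: minus_eq)
  then show ?thesis by blast
qed

subsection \<open>Characteristic zero\<close>

text \<open>
  The rotation by a quarter turn, conjugated by the translation by \<open>t\<close>. It acts on rows as the
  matrix \<open>((t, - 1 - t\<^sup>2), (1, - t))\<close>, and its square is \<open>- 1\<close>.
\<close>

definition quarter_turn :: "int \<Rightarrow> int \<times> int \<Rightarrow> int \<times> int" where
  "quarter_turn t = (\<lambda>(p, q). (t * p + q, (- 1 - t\<^sup>2) * p - t * q))"

text \<open>
  The rows obtained from \<open>\<plusminus> (1, 0)\<close> by reduced words in the first \<open>n\<close> quarter turns, that is,
  words with no letter repeated immediately. The tag is the last letter applied. Since each letter
  is its own inverse up to sign, reduced words yield the whole orbit.
\<close>

inductive ping_pong :: "nat \<Rightarrow> nat option \<Rightarrow> int \<times> int \<Rightarrow> bool" for n where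
  base: "\<bar>\<epsilon>\<bar> = 1 \<Longrightarrow> ping_pong n None (\<epsilon>, 0)"
| turn: "ping_pong n j v \<Longrightarrow> i < n \<Longrightarrow> j \<noteq> Some i
    \<Longrightarrow> ping_pong n (Some i) (quarter_turn (2 * int i + 2) v)"

lemma ping_pong_neg: "ping_pong n j v \<Longrightarrow> ping_pong n j (- fst v, - snd v)"
proof (induction rule: ping_pong.induct)
  case (base \<epsilon>)
  then show ?case using ping_pong.base[of "- \<epsilon>"] by simp
next
  case (turn j v i)
  have "quarter_turn (2 * int i + 2) (- fst v, - snd v)
    = (- fst (quarter_turn (2 * int i + 2) v), - snd (quarter_turn (2 * int i + 2) v))"
    by (simp add: quarter_turn_def case_prod_beta algebra_simps)
  then show ?case using ping_pong.turn[OF turn.IH turn.hyps(2,3)] by simp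
qed

lemma quarter_turn_twice: "quarter_turn t (quarter_turn t v) = (- fst v, - snd v)"
  by (cases v) (simp add: quarter_turn_def algebra_simps power2_eq_square)

lemma ping_pong_quarter_turn:
  assumes "ping_pong n j v" "i < n"
  shows "\<exists>j'. ping_pong n j' (quarter_turn (2 * int i + 2) v)"
proof (cases "j = Some i")
  case True
  then obtain j' w where "ping_pong n j' w" "v = quarter_turn (2 * int i + 2) w"
    using assms(1) by (auto elim: ping_pong.cases)
  then show ?thesis using ping_pong_neg quarter_turn_twice by metis
next
  case False
  then show ?thesis using ping_pong.turn[OF assms] by blast
qed

text \<open>
  In terms of \<open>x = - q / p\<close> the quarter turn at \<open>t\<close> maps everything with
  \<open>\<bar>x - t\<bar> > 1\<close> into \<open>\<bar>x - t\<bar> < 1\<close>. As the centres \<open>2 i + 2\<close> have distance at least two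
  from each other, the intervals are disjoint, and the last letter of a reduced word can be read off
  from the interval in which the row ends up. No centre is \<open>0\<close>, which keeps the starting row
  \<open>(1, 0)\<close> outside all intervals.
\<close>

lemma ping_pong_region:
  assumes "ping_pong n j (p, q)"
  shows "case j of None \<Rightarrow> \<bar>p\<bar> = 1 \<and> q = 0 | Some i \<Rightarrow> i < n \<and> \<bar>q + (2 * int i + 2) * p\<bar> < \<bar>p\<bar>"
  using assms
proof (induction j "(p, q)" arbitrary: p q rule: ping_pong.induct)
  case (turn j v i)
  obtain p' q' where v: "v = (p', q')" by (cases v)
  define t where "t = 2 * int i + 2"
  have "\<bar>p'\<bar> < \<bar>t * p' + q'\<bar>"
  proof (cases j)
    case None
    then have "\<bar>p'\<bar> = 1" "q' = 0" using turn(2)[OF v] by auto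
    then show ?thesis by (simp add: abs_mult t_def)
  next
    case (Some k)
    then have k: "\<bar>q' + (2 * int k + 2) * p'\<bar> < \<bar>p'\<bar>" "k \<noteq> i"
      using turn(2)[OF v] turn(4) by auto
    have "t * p' + q' - (q' + (2 * int k + 2) * p') = 2 * (int i - int k) * p'"
      by (simp add: t_def algebra_simps)
    then have "\<bar>t * p' + q' - (q' + (2 * int k + 2) * p')\<bar> = 2 * (\<bar>int i - int k\<bar> * \<bar>p'\<bar>)"
      by (simp only: abs_mult abs_numeral mult.assoc)
    moreover have "1 * \<bar>p'\<bar> \<le> \<bar>int i - int k\<bar> * \<bar>p'\<bar>"
      using k(2) by (intro mult_right_mono) auto
    ultimately show ?thesis using k(1) by linarith
  qed
  moreover have "p = t * p' + q'" "q + t * p = - p'"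
    using turn(5) v by (auto simp: quarter_turn_def t_def algebra_simps power2_eq_square)
  ultimately show ?case using turn(3) by (simp add: t_def)
qed simp

text \<open>
  The turn with index \<open>n\<close> moves \<open>(1, 0)\<close> into its own interval, which is disjoint from those of the
  previous turns.
\<close>

lemma ping_pong_new_turn:
  assumes "ping_pong n j (quarter_turn (2 * int n + 2) (1, 0))"
  shows False
proof -
  define t where "t = 2 * int n + 2"
  have "ping_pong n j (t, - 1 - t\<^sup>2)"
    using assms by (simp add: quarter_turn_def t_def)
  note region = ping_pong_region[OF this]
  show False
  proof (cases j)
    case None
    then show False using region by (simp add: t_def)
  next
    case (Some i)
    then have i: "i < n" "\<bar>- 1 - t\<^sup>2 + (2 * int i + 2) * t\<bar> < \<bar>t\<bar>" using region by auto
    have "(2 * int i + 2) * t \<le> (t - 2) * t"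
      using i(1) by (intro mult_right_mono) (auto simp: t_def)
    then show False using i(2) by (simp add: power2_eq_square algebra_simps t_def)
  qed
qed

text \<open>
  The integers embed into the ring, so the ping-pong argument can be carried over. Saturation of
  \<open>P n\<close> needs both directions; the converse one follows since turning twice is negation and
  \<open>P n\<close> is closed under it.
\<close>

lemma (in cring) separating_matrices_char_zero:
  assumes "\<And>m::nat. m > 0 \<Longrightarrow> [m] \<cdot> \<one> \<noteq> \<zero>"
  shows "\<exists>a b c d P. separating_matrices a b c d P"
proof -
  define emb :: "int \<Rightarrow> 'a" where "emb j = [j] \<cdot> \<one>" for j
  have emb_closed: "emb j \<in> carrier R" for j by (simp add: emb_def add.int_pow_closed)
  have emb_add: "emb (i + j) = emb i \<oplus> emb j" for i j
    by (simp add: emb_def add.int_pow_mult)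
  have emb_neg: "emb (- i) = \<ominus> emb i" for i
    by (simp add: emb_def add.int_pow_neg)
  have emb_mult: "emb (i * j) = emb i \<otimes> emb j" for i j
  proof -
    have "emb i \<otimes> emb j = [i] \<cdot> (\<one> \<otimes> [j] \<cdot> \<one>)"
      unfolding emb_def by (intro add_pow_ldistr_int) (auto simp: add.int_pow_closed)
    also have "\<dots> = emb (i * j)"
      by (simp add: emb_def add.int_pow_pow add.int_pow_closed mult.commute)
    finally show ?thesis ..
  qed
  have emb_1: "emb 1 = \<one>" and emb_0: "emb 0 = \<zero>" by (simp_all add: emb_def add_pow_int_ge)
  have emb_ne: "emb j \<noteq> \<zero>" if "j > 0" for j
    using that assms[of "nat j"] by (simp add: emb_def add_pow_int_ge)
  have emb_inj: "i = j" if "emb i = emb j" for i j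
  proof (rule ccontr)
    assume ne: "i \<noteq> j"
    have "emb (i - j) = \<zero>" "emb (j - i) = \<zero>"
      using emb_add[of i "- j"] emb_add[of j "- i"] that emb_closed
      by (simp_all add: emb_neg r_neg)
    then show False using ne emb_ne[of "i - j"] emb_ne[of "j - i"] by linarith
  qed
  define t where "t n = 2 * int n + 2" for n
  define P where "P n = {(emb p, emb q) | p q. \<exists>j. ping_pong n j (p, q)}" for n
  define turn where "turn n = (\<lambda>(p, q). (emb (t n) \<otimes> p \<oplus> \<one> \<otimes> q, emb (- 1 - (t n)\<^sup>2) \<otimes> p \<oplus> emb (- t n) \<otimes> q))" for n
  have emb_turn: "turn n (emb p, emb q) = (emb p', emb q')"
    if "quarter_turn (t n) (p, q) = (p', q')" for n p q p' q'
    using that emb_closed by (auto simp: quarter_turn_def turn_def emb_add[symmetric] emb_mult[symmetric])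
  have turn_twice: "turn n (turn n (p, q)) = (\<ominus> p, \<ominus> q)"
    if pq: "p \<in> carrier R" "q \<in> carrier R" for n p q
  proof -
    define T where "T = emb (t n)"
    have T: "T \<in> carrier R" by (simp add: T_def emb_closed)
    have b: "emb (- 1 - (t n)\<^sup>2) = \<ominus> \<one> \<ominus> T \<otimes> T"
      using emb_add[of "- 1" "- (t n)\<^sup>2"]
      by (simp add: emb_neg emb_1 power2_eq_square emb_mult T_def minus_eq)
    have d: "emb (- t n) = \<ominus> T" by (simp add: emb_neg T_def)
    have "T \<otimes> (T \<otimes> p \<oplus> q) \<oplus> ((\<ominus> \<one> \<ominus> T \<otimes> T) \<otimes> p \<oplus> \<ominus> T \<otimes> q) = \<ominus> p"
      using T pq by algebra
    moreover have "(\<ominus> \<one> \<ominus> T \<otimes> T) \<otimes> (T \<otimes> p \<oplus> q) \<oplus> \<ominus> T \<otimes> ((\<ominus> \<one> \<ominus> T \<otimes> T) \<otimes> p \<oplus> \<ominus> T \<otimes> q) = \<ominus> q"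
      using T pq by algebra
    ultimately show ?thesis using T pq by (simp add: turn_def b d flip: T_def)
  qed
  have P_turn: "turn i v \<in> P n" if vi: "v \<in> P n" "i < n" for i n v
  proof -
    obtain p q j where v: "v = (emb p, emb q)" "ping_pong n j (p, q)"
      using vi(1) by (auto simp: P_def)
    obtain p' q' where pq': "quarter_turn (t i) (p, q) = (p', q')" by (cases "quarter_turn (t i) (p, q)")
    then have "\<exists>j'. ping_pong n j' (p', q')"
      using ping_pong_quarter_turn[OF v(2) vi(2)] by (simp add: t_def)
    then show ?thesis using emb_turn[OF pq'] v(1) by (auto simp: P_def)
  qed
  have P_neg: "(\<ominus> p, \<ominus> q) \<in> P n" if pq_in: "(p, q) \<in> P n" for p q n
  proof -
    obtain p' q' j where pq: "p = emb p'" "q = emb q'" "ping_pong n j (p', q')"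
      using pq_in by (auto simp: P_def)
    have "ping_pong n j (- p', - q')" using ping_pong_neg[OF pq(3)] by simp
    moreover have "\<ominus> p = emb (- p')" "\<ominus> q = emb (- q')" using pq by (simp_all add: emb_neg)
    ultimately show ?thesis by (auto simp: P_def)
  qed
  have sat: "turn i (p, q) \<in> P n \<longleftrightarrow> (p, q) \<in> P n"
    if "i < n" "p \<in> carrier R" "q \<in> carrier R" for i n p q
  proof
    assume "turn i (p, q) \<in> P n"
    then have "(\<ominus> p, \<ominus> q) \<in> P n" using P_turn turn_twice that by metis
    then show "(p, q) \<in> P n" using P_neg that by fastforce
  qed (use P_turn that in blast)
  have "(\<one>, \<zero>) \<in> P n" for n
    using ping_pong.base[of 1 n] emb_0 emb_1 unfolding P_def by force
  moreover have "(emb (t n), emb (- 1 - (t n)\<^sup>2)) \<notin> P n" for n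
    using ping_pong_new_turn[of n] by (auto simp: P_def quarter_turn_def t_def dest!: emb_inj)
  moreover have "emb (t n) \<otimes> emb (- t n) \<ominus> emb (- 1 - (t n)\<^sup>2) \<otimes> \<one> = \<one>" for n
  proof -
    have "emb (t n) \<otimes> emb (- t n) \<ominus> emb (- 1 - (t n)\<^sup>2) \<otimes> \<one>
      = emb (t n * (- t n) + - ((- 1 - (t n)\<^sup>2) * 1))"
      unfolding emb_add emb_mult emb_neg emb_1 minus_eq ..
    then show ?thesis by (simp add: power2_eq_square emb_1)
  qed
  ultimately have "separating_matrices (\<lambda>n. emb (t n)) (\<lambda>n. emb (- 1 - (t n)\<^sup>2)) (\<lambda>_. \<one>) (\<lambda>n. emb (- t n)) P"
    using sat emb_closed unfolding separating_matrices_def turn_def by simp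
  then show ?thesis by blast
qed

lemma (in cring) exists_separating_matrices:
  assumes "infinite (carrier R)"
  shows "\<exists>a b c d P. separating_matrices a b c d P"
  using separating_matrices_positive_char[OF _ _ assms] separating_matrices_char_zero by blast

section \<open>The free module of rank two\<close>

definition vec :: "'r ring \<Rightarrow> 'r \<Rightarrow> 'r \<Rightarrow> nat \<Rightarrow> 'r" where
  "vec R x y = (\<lambda>i. if i = 0 then x else if i = 1 then y else \<zero>\<^bsub>R\<^esub>)"

definition plane :: "'r ring \<Rightarrow> 'r fmod" where
  "plane R = \<lparr>carrier = {vec R x y | x y. x \<in> carrier R \<and> y \<in> carrier R},
     mult = (\<lambda>u v. u), one = vec R \<zero>\<^bsub>R\<^esub> \<zero>\<^bsub>R\<^esub>, zero = vec R \<zero>\<^bsub>R\<^esub> \<zero>\<^bsub>R\<^esub>,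
     add = (\<lambda>u v. vec R (u 0 \<oplus>\<^bsub>R\<^esub> v 0) (u 1 \<oplus>\<^bsub>R\<^esub> v 1)),
     smult = (\<lambda>a v. vec R (a \<otimes>\<^bsub>R\<^esub> v 0) (a \<otimes>\<^bsub>R\<^esub> v 1))\<rparr>"

definition matrix_map :: "'r ring \<Rightarrow> 'r \<Rightarrow> 'r \<Rightarrow> 'r \<Rightarrow> 'r \<Rightarrow> 'r fmap" where
  "matrix_map R a b c d = (\<lambda>v\<in>carrier (plane R).
     vec R (a \<otimes>\<^bsub>R\<^esub> v 0 \<oplus>\<^bsub>R\<^esub> b \<otimes>\<^bsub>R\<^esub> v 1) (c \<otimes>\<^bsub>R\<^esub> v 0 \<oplus>\<^bsub>R\<^esub> d \<otimes>\<^bsub>R\<^esub> v 1))"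

lemma vec_simps [simp]: "vec R x y 0 = x" "vec R x y (Suc 0) = y"
  by (simp_all add: vec_def)

lemma vec_eq_iff [simp]: "vec R x y = vec R x' y' \<longleftrightarrow> x = x' \<and> y = y'"
  by (metis vec_simps)

lemma plane_simps:
  "carrier (plane R) = {vec R x y | x y. x \<in> carrier R \<and> y \<in> carrier R}"
  "\<zero>\<^bsub>plane R\<^esub> = vec R \<zero>\<^bsub>R\<^esub> \<zero>\<^bsub>R\<^esub>"
  "u \<oplus>\<^bsub>plane R\<^esub> v = vec R (u 0 \<oplus>\<^bsub>R\<^esub> v 0) (u 1 \<oplus>\<^bsub>R\<^esub> v 1)"
  "a \<odot>\<^bsub>plane R\<^esub> v = vec R (a \<otimes>\<^bsub>R\<^esub> v 0) (a \<otimes>\<^bsub>R\<^esub> v 1)"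
  by (simp_all add: plane_def)

text \<open>
  A commutative ring of exactly the record type \<open>'a ring\<close>, over which the objects of the three
  categories are defined.
\<close>

locale base_ring = cring R for R :: "'a ring" (structure)
begin

lemma module_plane: "module R (plane R)"
proof (intro moduleI abelian_groupI cring_axioms)
  fix x assume "x \<in> carrier (plane R)"
  then obtain p q where x: "x = vec R p q" "p \<in> carrier R" "q \<in> carrier R"
    by (auto simp: plane_simps)
  then show "\<exists>y\<in>carrier (plane R). y \<oplus>\<^bsub>plane R\<^esub> x = \<zero>\<^bsub>plane R\<^esub>"
    by (intro bexI[of _ "vec R (\<ominus> p) (\<ominus> q)"]) (auto simp: plane_simps l_neg)
qed (auto simp: plane_simps a_ac m_ac l_distr r_distr)

lemma basis_plane:
  assumes "\<one> \<noteq> \<zero>"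
  shows "is_basis R (plane R) {vec R \<one> \<zero>, vec R \<zero> \<one>}"
proof -
  interpret plane: module R "plane R" by (rule module_plane)
  let ?e = "vec R \<one> \<zero>" and ?f = "vec R \<zero> \<one>"
  have ef: "?e \<noteq> ?f" "?e \<in> carrier (plane R)" "?f \<in> carrier (plane R)"
    using assms by (auto simp: plane_simps)
  have pair: "(\<Oplus>\<^bsub>plane R\<^esub>b\<in>{?e, ?f}. c b \<odot>\<^bsub>plane R\<^esub> b) = vec R (c ?e) (c ?f)"
    if "c ?e \<in> carrier R" "c ?f \<in> carrier R" for c
    using ef that by (simp add: plane.finsum_insert Pi_def) (simp add: plane_simps)
  have single: "(\<Oplus>\<^bsub>plane R\<^esub>b\<in>{v}. c b \<odot>\<^bsub>plane R\<^esub> b) = c v \<odot>\<^bsub>plane R\<^esub> v"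
    if "c v \<in> carrier R" "v \<in> carrier (plane R)" for c v
    using that by (simp add: plane.finsum_insert Pi_def)
  show ?thesis
    unfolding is_basis_def
  proof (intro conjI ballI allI impI)
    show "{?e, ?f} \<subseteq> carrier (plane R)" using ef by simp
  next
    fix v assume "v \<in> carrier (plane R)"
    then obtain x y where v: "v = vec R x y" "x \<in> carrier R" "y \<in> carrier R"
      by (auto simp: plane_simps)
    define c where "c b = (if b = ?e then x else y)" for b
    have "c ?e = x" "c ?f = y" using ef by (simp_all add: c_def)
    then have "v = (\<Oplus>\<^bsub>plane R\<^esub>b\<in>{?e, ?f}. c b \<odot>\<^bsub>plane R\<^esub> b)"
      "c \<in> {?e, ?f} \<rightarrow> carrier R"
      using pair[of c] v by auto
    then show "\<exists>A c. finite A \<and> A \<subseteq> {?e, ?f} \<and> c \<in> A \<rightarrow> carrier R \<and>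
        v = (\<Oplus>\<^bsub>plane R\<^esub>b\<in>A. c b \<odot>\<^bsub>plane R\<^esub> b)"
      by (intro exI[of _ "{?e, ?f}"] exI[of _ c] conjI) simp_all
  next
    fix A c b
    assume *: "finite A \<and> A \<subseteq> {?e, ?f} \<and> c \<in> A \<rightarrow> carrier R \<and>
        (\<Oplus>\<^bsub>plane R\<^esub>b\<in>A. c b \<odot>\<^bsub>plane R\<^esub> b) = \<zero>\<^bsub>plane R\<^esub>" and b: "b \<in> A"
    have "A = {x} \<or> A = {y} \<or> A = {x, y}" if "A \<subseteq> {x, y}" for x y
      using that b by blast
    moreover from * have "A \<subseteq> {?e, ?f}" by (elim conjE)
    ultimately have "A = {?e} \<or> A = {?f} \<or> A = {?e, ?f}" .
    then show "c b = \<zero>"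
    proof (elim disjE)
      assume A: "A = {?e}"
      show ?thesis using A * b single[of c ?e] ef by (auto simp: plane_simps)
    next
      assume A: "A = {?f}"
      show ?thesis using A * b single[of c ?f] ef by (auto simp: plane_simps)
    next
      assume A: "A = {?e, ?f}"
      then have "c ?e \<in> carrier R" "c ?f \<in> carrier R" using * by auto
      then show ?thesis using * b A pair[of c] by (auto simp: plane_simps)
    qed
  qed
qed

lemma finite_rank_free_plane:
  assumes "\<one> \<noteq> \<zero>"
  shows "finite_rank_free R (plane R)"
  unfolding finite_rank_free_def
  by (intro conjI module_plane exI[of _ "{vec R \<one> \<zero>, vec R \<zero> \<one>}"] basis_plane[OF assms]) simp

lemma matrix_map_linear:
  assumes "a \<in> carrier R" "b \<in> carrier R" "c \<in> carrier R" "d \<in> carrier R"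
  shows "matrix_map R a b c d \<in> linear_maps R (plane R) (plane R)"
proof -
  have "a \<otimes> (x \<oplus> y) \<oplus> b \<otimes> (z \<oplus> w) = (a \<otimes> x \<oplus> b \<otimes> z) \<oplus> (a \<otimes> y \<oplus> b \<otimes> w)"
    if "a \<in> carrier R" "b \<in> carrier R" "x \<in> carrier R" "y \<in> carrier R" "z \<in> carrier R" "w \<in> carrier R"
    for a b x y z w using that by algebra
  moreover have "a \<otimes> (r \<otimes> x) \<oplus> b \<otimes> (r \<otimes> y) = r \<otimes> (a \<otimes> x \<oplus> b \<otimes> y)"
    if "a \<in> carrier R" "b \<in> carrier R" "x \<in> carrier R" "y \<in> carrier R" "r \<in> carrier R"
    for a b x y r using that by algebra
  ultimately show ?thesis
    using assms by (auto simp: linear_maps_def matrix_map_def plane_simps)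
qed

text \<open>
  The product of a matrix with its adjugate is the determinant times the identity.
\<close>

lemma matrix_map_adjugate:
  assumes "a \<in> carrier R" "b \<in> carrier R" "c \<in> carrier R" "d \<in> carrier R"
    and det: "a \<otimes> d \<ominus> b \<otimes> c = \<one>" and v: "v \<in> carrier (plane R)"
  shows "matrix_map R d (\<ominus> b) (\<ominus> c) a (matrix_map R a b c d v) = v"
proof -
  obtain x y where xy: "v = vec R x y" "x \<in> carrier R" "y \<in> carrier R"
    using v by (auto simp: plane_simps)
  have "d \<otimes> (a \<otimes> x \<oplus> b \<otimes> y) \<oplus> \<ominus> b \<otimes> (c \<otimes> x \<oplus> d \<otimes> y) = (a \<otimes> d \<ominus> b \<otimes> c) \<otimes> x"
    using assms(1-4) xy(2,3) by algebra
  moreover have "\<ominus> c \<otimes> (a \<otimes> x \<oplus> b \<otimes> y) \<oplus> a \<otimes> (c \<otimes> x \<oplus> d \<otimes> y) = (a \<otimes> d \<ominus> b \<otimes> c) \<otimes> y"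
    using assms(1-4) xy(2,3) by algebra
  moreover have "matrix_map R a b c d v = vec R (a \<otimes> x \<oplus> b \<otimes> y) (c \<otimes> x \<oplus> d \<otimes> y)"
    using v xy(1) by (simp add: matrix_map_def)
  ultimately show ?thesis
    using assms(1-4) xy by (auto simp: matrix_map_def plane_simps det)
qed

lemma matrix_map_bij:
  assumes "a \<in> carrier R" "b \<in> carrier R" "c \<in> carrier R" "d \<in> carrier R"
    and det: "a \<otimes> d \<ominus> b \<otimes> c = \<one>"
  shows "bij_betw (matrix_map R a b c d) (carrier (plane R)) (carrier (plane R))"
proof -
  have det': "d \<otimes> a \<ominus> (\<ominus> b) \<otimes> (\<ominus> c) = \<one>"
    using assms(1-4) by (simp add: m_comm[of d a] l_minus r_minus det)
  have inv: "matrix_map R a b c d (matrix_map R d (\<ominus> b) (\<ominus> c) a v) = v"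
    if "v \<in> carrier (plane R)" for v
    using matrix_map_adjugate[OF assms(4) _ _ assms(1) det' that] assms(1-4) by simp
  show ?thesis
    using matrix_map_adjugate[OF assms] inv matrix_map_linear assms(1-4)
    by (intro bij_betw_byWitness[of _ "matrix_map R d (\<ominus> b) (\<ominus> c) a"])
       (auto simp: linear_maps_def Pi_def)
qed

text \<open>
  The common treatment of the three categories: \<open>und\<close> and \<open>U\<close> are the forgetful functor to
  modules and injective linear maps, and it is enough that all matrices of determinant one are
  automorphisms of an object over \<open>R\<^sup>2\<close>. The functor of pairs of vectors, with the right action of
  separating matrices, then satisfies the assumptions of \<open>endo_sequence\<close>.
\<close>

lemma not_locally_noetherian_if_plane_automorphisms:
  fixes C :: "('o, 'm) category" and und :: "'o \<Rightarrow> 'a fmod" and U :: "'m \<Rightarrow> 'a fmap"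
    and \<epsilon> :: "'a fmap \<Rightarrow> 'm"
  assumes inf: "infinite (carrier R)" and k: "\<exists>a b :: 'k. a \<noteq> b"
    and und: "\<And>X. X \<in> Obj C \<Longrightarrow> module R (und X)"
    and linear: "\<And>X Y f. \<lbrakk>X \<in> Obj C; Y \<in> Obj C; f \<in> Mor C X Y\<rbrakk> \<Longrightarrow> U f \<in> linear_maps R (und X) (und Y)"
    and inj: "\<And>X Y f. \<lbrakk>X \<in> Obj C; Y \<in> Obj C; f \<in> Mor C X Y\<rbrakk> \<Longrightarrow> inj_on (U f) (carrier (und X))"
    and ident: "\<And>X x. \<lbrakk>X \<in> Obj C; x \<in> carrier (und X)\<rbrakk> \<Longrightarrow> U (Ident C X) x = x"
    and compos: "\<And>X Y Z f g x. \<lbrakk>X \<in> Obj C; Y \<in> Obj C; Z \<in> Obj C; f \<in> Mor C X Y; g \<in> Mor C Y Z;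
      x \<in> carrier (und X)\<rbrakk> \<Longrightarrow> U (Compos C X Y Z g f) x = U g (U f x)"
    and A: "A \<in> Obj C" "und A = plane R"
    and autos: "\<And>a b c d. \<lbrakk>a \<in> carrier R; b \<in> carrier R; c \<in> carrier R; d \<in> carrier R;
      a \<otimes> d \<ominus> b \<otimes> c = \<one>\<rbrakk> \<Longrightarrow> \<exists>s\<in>Mor C A A. U s = matrix_map R a b c d"
    and \<epsilon>: "inj \<epsilon>"
  shows "\<not> locally_noetherian TYPE('k) C"
proof -
  have one_ne: "\<one> \<noteq> \<zero>" using inf one_zeroD by force
  obtain a b c d P where "separating_matrices a b c d P"
    using exists_separating_matrices[OF inf] by blast
  then have abcd: "a n \<in> carrier R" "b n \<in> carrier R" "c n \<in> carrier R" "d n \<in> carrier R"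
    and det: "a n \<otimes> d n \<ominus> b n \<otimes> c n = \<one>"
    and P: "(\<one>, \<zero>) \<in> P n" "(a n, b n) \<notin> P n"
    and sat: "\<And>i p q. \<lbrakk>i < n; p \<in> carrier R; q \<in> carrier R\<rbrakk> \<Longrightarrow>
      (a i \<otimes> p \<oplus> c i \<otimes> q, b i \<otimes> p \<oplus> d i \<otimes> q) \<in> P n \<longleftrightarrow> (p, q) \<in> P n" for n
    unfolding separating_matrices_def by auto
  have "\<forall>n. \<exists>s\<in>Mor C A A. U s = matrix_map R (a n) (b n) (c n) (d n)"
    using autos[OF abcd det] by (rule allI)
  then obtain s where s: "\<And>n. s n \<in> Mor C A A"
    "\<And>n. U (s n) = matrix_map R (a n) (b n) (c n) (d n)" by metis
  define \<tau> where "\<tau> i X = (\<lambda>(x, y).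
    (a i \<odot>\<^bsub>und X\<^esub> x \<oplus>\<^bsub>und X\<^esub> c i \<odot>\<^bsub>und X\<^esub> y, b i \<odot>\<^bsub>und X\<^esub> x \<oplus>\<^bsub>und X\<^esub> d i \<odot>\<^bsub>und X\<^esub> y))" for i X
  define K :: "nat \<Rightarrow> ((nat \<Rightarrow> 'a) \<times> (nat \<Rightarrow> 'a)) set"
    where "K n = {(x, y). (x 0, y 0) \<in> P n}" for n
  have natural: "\<tau> i Y (map_prod (U f) (U f) v) = map_prod (U f) (U f) (\<tau> i X v)"
    if Xf: "X \<in> Obj C" "Y \<in> Obj C" "f \<in> Mor C X Y" and v: "v \<in> carrier (und X) \<times> carrier (und X)"
    for i X Y f v
  proof -
    interpret X: module R "und X" by (rule und[OF Xf(1)])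
    obtain x y where "v = (x, y)" "x \<in> carrier (und X)" "y \<in> carrier (und X)" using v by blast
    then show ?thesis
      using linear[OF Xf] abcd by (simp add: \<tau>_def linear_maps_def)
  qed
  have saturated: "\<tau> i A v \<in> K n \<longleftrightarrow> v \<in> K n"
    if "i < n" "v \<in> carrier (und A) \<times> carrier (und A)" for i n v
    using that sat abcd by (auto simp: \<tau>_def K_def A(2) plane_simps)
  have \<tau>_start: "\<tau> i A (vec R \<one> \<zero>, vec R \<zero> \<one>) = (vec R (a i) (c i), vec R (b i) (d i))" for i
    using abcd by (simp add: \<tau>_def A(2) plane_simps)
  interpret endo_sequence C "\<lambda>X. carrier (und X) \<times> carrier (und X)" "\<lambda>f. map_prod (U f) (U f)"
    A "(vec R \<one> \<zero>, vec R \<zero> \<one>)" s \<tau> K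
  proof
    show "\<tau> i A (vec R \<one> \<zero>, vec R \<zero> \<one>)
      = map_prod (U (s i)) (U (s i)) (vec R \<one> \<zero>, vec R \<zero> \<one>)" for i
      using abcd by (auto simp: \<tau>_start s(2) matrix_map_def plane_simps)
    show "inj_on (map_prod (U f) (U f)) (carrier (und X) \<times> carrier (und X))"
      if "X \<in> Obj C" "Y \<in> Obj C" "f \<in> Mor C X Y" for X Y f
      using inj[OF that] by (rule map_prod_inj_on) (rule inj[OF that])
    show "map_prod (U f) (U f) v \<in> carrier (und Y) \<times> carrier (und Y)"
      if "X \<in> Obj C" "Y \<in> Obj C" "f \<in> Mor C X Y" "v \<in> carrier (und X) \<times> carrier (und X)" for X Y f v
      using linear[OF that(1-3)] that(4) by (auto simp: linear_maps_def)
    show "(vec R \<one> \<zero>, vec R \<zero> \<one>) \<in> K n" for n using P by (simp add: K_def)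
    show "\<tau> n A (vec R \<one> \<zero>, vec R \<zero> \<one>) \<notin> K n" for n using P by (simp add: K_def \<tau>_start)
    show "(vec R \<one> \<zero>, vec R \<zero> \<one>) \<in> carrier (und A) \<times> carrier (und A)"
      by (auto simp: A(2) plane_simps)
  qed (use A s natural saturated ident compos in auto)
  \<comment> \<open>A pair of vectors is stored in a map of vectors that takes both as values.\<close>
  define code :: "(nat \<Rightarrow> 'a) \<times> (nat \<Rightarrow> 'a) \<Rightarrow> 'a fmap"
    where "code = (\<lambda>(x, y) z. if z = (\<lambda>_. \<zero>) then x else y)"
  have code: "code (x, y) (\<lambda>_. \<zero>) = x" "code (x, y) (\<lambda>_. \<one>) = y" for x y
    using one_ne by (auto simp: code_def fun_eq_iff)
  have "inj code"
    by (rule injI) (metis code prod.collapse)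
  then have "inj (\<epsilon> \<circ> code)" using \<epsilon> by (simp add: inj_compose)
  then show ?thesis by (rule not_locally_noetherian[OF _ k])
qed

end

section \<open>The three categories\<close>

lemma (in base_ring) VI_not_locally_noetherian:
  assumes inf: "infinite (carrier R)" and k: "\<exists>a b :: 'k. a \<noteq> b"
  shows "\<not> locally_noetherian TYPE('k) (VI R)"
proof (rule not_locally_noetherian_if_plane_automorphisms[OF inf k,
      where und = "\<lambda>V. V" and U = "\<lambda>f. f" and \<epsilon> = "\<lambda>f. f" and A = "plane R"])
  have "\<one> \<noteq> \<zero>" using inf one_zeroD by force
  then show "plane R \<in> Obj (VI R)" by (simp add: VI_def finite_rank_free_plane)
  fix a b c d assume abcd: "a \<in> carrier R" "b \<in> carrier R" "c \<in> carrier R" "d \<in> carrier R"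
    and det: "a \<otimes> d \<ominus> b \<otimes> c = \<one>"
  have "\<exists>h\<in>linear_maps R (plane R) (plane R). \<forall>v\<in>carrier (plane R). h (matrix_map R a b c d v) = v"
    using matrix_map_adjugate[OF abcd det] matrix_map_linear[of d "\<ominus> b" "\<ominus> c" a] abcd by blast
  then show "\<exists>s\<in>Mor (VI R) (plane R) (plane R). s = matrix_map R a b c d"
    using matrix_map_linear[OF abcd] matrix_map_bij[OF abcd det]
    by (simp add: VI_def bij_betw_def) (simp add: matrix_map_def)
qed (auto simp: VI_def finite_rank_free_def compose_def)

text \<open>
  An automorphism becomes a morphism of VIC with the zero complement, which is free on the empty
  basis.
\<close>

lemma (in base_ring) VIC_not_locally_noetherian:
  assumes inf: "infinite (carrier R)" and k: "\<exists>a b :: 'k. a \<noteq> b"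
  shows "\<not> locally_noetherian TYPE('k) (VIC R)"
proof (rule not_locally_noetherian_if_plane_automorphisms[OF inf k,
      where und = "\<lambda>V. V" and U = fst and \<epsilon> = "\<lambda>f. (f, {})" and A = "plane R"])
  interpret plane: module R "plane R" by (rule module_plane)
  have "\<one> \<noteq> \<zero>" using inf one_zeroD by force
  then show "plane R \<in> Obj (VIC R)" by (simp add: VIC_def finite_rank_free_plane)
  let ?zero = "{\<zero>\<^bsub>plane R\<^esub>}"
  have sub: "submodule ?zero R (plane R)"
    by (intro plane.submoduleI) auto
  have "is_basis R (plane R\<lparr>carrier := ?zero\<rparr>) {}"
    by (auto simp: is_basis_def finsum_def finprod_def)
  then have free: "free_module R (plane R\<lparr>carrier := ?zero\<rparr>)"
    using submodule.submodule_is_module[OF sub module_plane] by (auto simp: free_module_def)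
  fix a b c d assume abcd: "a \<in> carrier R" "b \<in> carrier R" "c \<in> carrier R" "d \<in> carrier R"
    and det: "a \<otimes> d \<ominus> b \<otimes> c = \<one>"
  have "carrier (plane R) <+>\<^bsub>plane R\<^esub> ?zero = carrier (plane R)"
    by (auto simp: set_add_def')
  then have "(matrix_map R a b c d, ?zero) \<in> Mor (VIC R) (plane R) (plane R)"
    using matrix_map_linear[OF abcd] matrix_map_bij[OF abcd det] sub free
    by (simp add: VIC_def bij_betw_def) (simp add: matrix_map_def)
  then show "\<exists>s\<in>Mor (VIC R) (plane R) (plane R). fst s = matrix_map R a b c d" by force
qed (auto simp: VIC_def finite_rank_free_def compose_def inj_def)

text \<open>
  A functional \<open>\<phi>\<close> is represented by the vector \<open>(\<phi> e\<^sub>2, - \<phi> e\<^sub>1)\<close>.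
\<close>

lemma (in base_ring) symplectic_plane:
  "symplectic_form R (plane R) (\<lambda>x y. x 0 \<otimes> y 1 \<ominus> x 1 \<otimes> y 0)"
proof -
  let ?\<omega> = "\<lambda>x y :: nat \<Rightarrow> 'a. x 0 \<otimes> y 1 \<ominus> x 1 \<otimes> y 0"
  let ?V = "carrier (plane R)"
  have add: "(x \<oplus> y) \<otimes> w \<ominus> (x' \<oplus> y') \<otimes> w' = (x \<otimes> w \<ominus> x' \<otimes> w') \<oplus> (y \<otimes> w \<ominus> y' \<otimes> w')"
    if "x \<in> carrier R" "y \<in> carrier R" "w \<in> carrier R" "x' \<in> carrier R" "y' \<in> carrier R" "w' \<in> carrier R"
    for x y w x' y' w' using that by algebra
  have add': "w \<otimes> (x \<oplus> y) \<ominus> w' \<otimes> (x' \<oplus> y') = (w \<otimes> x \<ominus> w' \<otimes> x') \<oplus> (w \<otimes> y \<ominus> w' \<otimes> y')"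
    if "x \<in> carrier R" "y \<in> carrier R" "w \<in> carrier R" "x' \<in> carrier R" "y' \<in> carrier R" "w' \<in> carrier R"
    for x y w x' y' w' using that by algebra
  have mult: "(r \<otimes> x) \<otimes> y \<ominus> (r \<otimes> x') \<otimes> y' = r \<otimes> (x \<otimes> y \<ominus> x' \<otimes> y')"
    if "r \<in> carrier R" "x \<in> carrier R" "y \<in> carrier R" "x' \<in> carrier R" "y' \<in> carrier R"
    for r x y x' y' using that by algebra
  have mult': "x \<otimes> (r \<otimes> y) \<ominus> x' \<otimes> (r \<otimes> y') = r \<otimes> (x \<otimes> y \<ominus> x' \<otimes> y')"
    if "r \<in> carrier R" "x \<in> carrier R" "y \<in> carrier R" "x' \<in> carrier R" "y' \<in> carrier R"
    for r x y x' y' using that by algebra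
  have bilinear: "bilinear_form R (plane R) ?\<omega>"
    unfolding bilinear_form_def by (auto simp: plane_simps add add' mult mult')
  have alternating: "?\<omega> x x = \<zero>" if "x \<in> ?V" for x
    using that by (auto simp: plane_simps m_comm minus_eq r_neg)
  have dual: "(\<lambda>y\<in>?V. ?\<omega> x y) \<in> dual_space R (plane R)" if x: "x \<in> ?V" for x
  proof -
    interpret plane: module R "plane R" by (rule module_plane)
    show ?thesis using bilinear x by (auto simp: dual_space_def bilinear_form_def)
  qed
  have basis: "vec R \<one> \<zero> \<in> ?V" "vec R \<zero> \<one> \<in> ?V" by (auto simp: plane_simps)
  have inj: "inj_on (\<lambda>x. \<lambda>y\<in>?V. ?\<omega> x y) ?V"
  proof (rule inj_onI)
    fix x y assume x: "x \<in> ?V" and y: "y \<in> ?V"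
      and eq: "(\<lambda>z\<in>?V. ?\<omega> x z) = (\<lambda>z\<in>?V. ?\<omega> y z)"
    have eq': "?\<omega> x z = ?\<omega> y z" if "z \<in> ?V" for z using fun_cong[OF eq, of z] that by simp
    obtain p q p' q' where xy: "x = vec R p q" "p \<in> carrier R" "q \<in> carrier R"
      "y = vec R p' q'" "p' \<in> carrier R" "q' \<in> carrier R" using x y by (auto simp: plane_simps)
    have "\<ominus> q = \<ominus> q'" using eq'[OF basis(1)] xy by (simp add: minus_eq)
    then have "q = q'" using xy by (metis minus_minus)
    moreover have "p = p'" using eq'[OF basis(2)] xy by (simp add: minus_eq)
    ultimately show "x = y" using xy by simp
  qed
  have surj: "\<exists>x\<in>?V. \<phi> = (\<lambda>y\<in>?V. ?\<omega> x y)" if \<phi>: "\<phi> \<in> dual_space R (plane R)" for \<phi>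
  proof -
    let ?x = "vec R (\<phi> (vec R \<zero> \<one>)) (\<ominus> \<phi> (vec R \<one> \<zero>))"
    have \<phi>_in: "\<phi> v \<in> carrier R" if "v \<in> ?V" for v using \<phi> that by (auto simp: dual_space_def)
    have x: "?x \<in> ?V" using \<phi>_in basis by (auto simp: plane_simps)
    have "\<phi> v = ?\<omega> ?x v" if v: "v \<in> ?V" for v
    proof -
      obtain p q where pq: "v = vec R p q" "p \<in> carrier R" "q \<in> carrier R"
        using v by (auto simp: plane_simps)
      let ?p = "p \<odot>\<^bsub>plane R\<^esub> vec R \<one> \<zero>" and ?q = "q \<odot>\<^bsub>plane R\<^esub> vec R \<zero> \<one>"
      have "v = ?p \<oplus>\<^bsub>plane R\<^esub> ?q" "?p \<in> ?V" "?q \<in> ?V"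
        using pq by (auto simp: plane_simps)
      then have "\<phi> v = \<phi> ?p \<oplus> \<phi> ?q" using \<phi> by (simp add: dual_space_def)
      also have "\<phi> ?p = p \<otimes> \<phi> (vec R \<one> \<zero>)" using \<phi> pq basis by (simp add: dual_space_def)
      also have "\<phi> ?q = q \<otimes> \<phi> (vec R \<zero> \<one>)" using \<phi> pq basis by (simp add: dual_space_def)
      also have "p \<otimes> \<phi> (vec R \<one> \<zero>) \<oplus> q \<otimes> \<phi> (vec R \<zero> \<one>) = ?\<omega> ?x v"
        using pq \<phi>_in[OF basis(1)] \<phi>_in[OF basis(2)]
        by (simp add: minus_eq l_minus r_minus m_comm a_comm)
      finally show ?thesis .
    qed
    moreover have "\<phi> \<in> extensional ?V" using \<phi> by (auto simp: dual_space_def PiE_def)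
    ultimately have "\<phi> = (\<lambda>y\<in>?V. ?\<omega> ?x y)" by (auto simp: extensional_def fun_eq_iff)
    then show ?thesis using x by blast
  qed
  show ?thesis
    unfolding symplectic_form_def bij_betw_def
    using bilinear alternating inj dual surj by (auto simp: image_iff)
qed

text \<open>
  A matrix multiplies the standard form of the plane by its determinant, so those of determinant one
  are symplectic. Morphisms are injective because the form on their source is nondegenerate.
\<close>

lemma (in base_ring) SI_not_locally_noetherian:
  assumes inf: "infinite (carrier R)" and k: "\<exists>a b :: 'k. a \<noteq> b"
  shows "\<not> locally_noetherian TYPE('k) (SI R)"
proof (rule not_locally_noetherian_if_plane_automorphisms[OF inf k,
      where und = fst and U = "\<lambda>f. f" and \<epsilon> = "\<lambda>f. f"
        and A = "(plane R, \<lambda>x y. x 0 \<otimes> y 1 \<ominus> x 1 \<otimes> y 0)"])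
  let ?A = "(plane R, \<lambda>x y :: nat \<Rightarrow> 'a. x 0 \<otimes> y 1 \<ominus> x 1 \<otimes> y 0)"
  have "\<one> \<noteq> \<zero>" using inf one_zeroD by force
  then show "?A \<in> Obj (SI R)" by (simp add: SI_def finite_rank_free_plane symplectic_plane del: One_nat_def)
  fix a b c d assume abcd: "a \<in> carrier R" "b \<in> carrier R" "c \<in> carrier R" "d \<in> carrier R"
    and det: "a \<otimes> d \<ominus> b \<otimes> c = \<one>"
  have "(a \<otimes> x \<oplus> b \<otimes> y) \<otimes> (c \<otimes> z \<oplus> d \<otimes> w) \<ominus> (c \<otimes> x \<oplus> d \<otimes> y) \<otimes> (a \<otimes> z \<oplus> b \<otimes> w) = x \<otimes> w \<ominus> y \<otimes> z"
    if "x \<in> carrier R" "y \<in> carrier R" "z \<in> carrier R" "w \<in> carrier R" for x y z w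
  proof -
    have "(a \<otimes> x \<oplus> b \<otimes> y) \<otimes> (c \<otimes> z \<oplus> d \<otimes> w) \<ominus> (c \<otimes> x \<oplus> d \<otimes> y) \<otimes> (a \<otimes> z \<oplus> b \<otimes> w)
      = (a \<otimes> d \<ominus> b \<otimes> c) \<otimes> (x \<otimes> w \<ominus> y \<otimes> z)"
      using abcd that by algebra
    then show ?thesis using that by (simp add: det)
  qed
  then show "\<exists>s\<in>Mor (SI R) ?A ?A. s = matrix_map R a b c d"
    using matrix_map_linear[OF abcd] abcd
    by (simp add: SI_def) (auto simp: matrix_map_def plane_simps)
next
  fix X Y f assume XYf: "X \<in> Obj (SI R)" "Y \<in> Obj (SI R)" "f \<in> Mor (SI R) X Y"
  obtain V \<omega> W \<eta> where XY: "X = (V, \<omega>)" "Y = (W, \<eta>)" by fastforce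
  show "inj_on f (carrier (fst X))"
  proof (rule inj_onI)
    fix x y assume xy: "x \<in> carrier (fst X)" "y \<in> carrier (fst X)" "f x = f y"
    then have "\<omega> x z = \<omega> y z" if "z \<in> carrier V" for z
      using XYf that by (simp add: XY SI_def) metis
    then have "(\<lambda>z\<in>carrier V. \<omega> x z) = (\<lambda>z\<in>carrier V. \<omega> y z)" by (rule restrict_ext)
    moreover have "inj_on (\<lambda>x. \<lambda>y\<in>carrier V. \<omega> x y) (carrier V)"
      using XYf by (auto simp: XY SI_def symplectic_form_def bij_betw_def)
    ultimately show "x = y" using xy by (auto simp: XY dest: inj_onD)
  qed
qed (auto simp: SI_def finite_rank_free_def compose_def)

theorem theorem14:
  fixes R :: "'r ring"
  assumes "cring R" and "infinite (carrier R)"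
    and "\<exists>a b :: 'k. a \<noteq> b"
  shows "\<not> locally_noetherian TYPE('k) (VI R) \<and>
    \<not> locally_noetherian TYPE('k) (VIC R) \<and>
    \<not> locally_noetherian TYPE('k) (SI R)"
proof -
  interpret base_ring R using assms(1) by (simp add: base_ring_def)
  show ?thesis
    using VI_not_locally_noetherian VIC_not_locally_noetherian SI_not_locally_noetherian assms(2,3)
    by blast
qed

end
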